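(* The Calkin algebra $\mathcal L(\mathfrak X_k)/\mathcal K(\mathfrak X_k)$ is $k$-dimensional with basis (the classes of) $I,S,\dots,S^{k-1}$. It is isomorphic as an algebra to the subalgebra $\mathcal A\cong\mathbb R[X]/\langle X^k\rangle$ of $k\times k$ upper-triangular Toeplitz real matrices, i.e. the subalgebra of $\mathrm{Mat}(k\times k)$ generated by $N^j$, $0\le j\le k-1$, where $N$ is the matrix with $1$'s on the first superdiagonal and $0$'s elsewhere; an explicit isomorphism $\psi\colon\mathcal L(\mathfrak X_k)/\mathcal K(\mathfrak X_k)\to\mathcal A$ is given by $\sum_{j=0}^{k-1}\lambda_jS^j\mapsto\sum_{j=0}^{k-1}\lambda_jN^j$. Moreover, $\mathfrak X_k$ has few operators but not very few operators: $$\mathbb R I+\mathcal K(\mathfrak X_k)\subsetneq\mathcal L(\mathfrak X_k)\subseteq\mathbb R I+\mathcal{SS}(\mathfrak X_k).$$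
   Context: Here $k\ge2$ is an integer, and $\mathfrak X_k$ is a real separable $\mathscr L_\infty$-space with a bounded linear operator $S\colon\mathfrak X_k\to\mathfrak X_k$ such that: (1) $\mathfrak X_k$ is hereditarily indecomposable and $\mathfrak X_k^*$ is isomorphic to $\ell_1$; (2) $S$ is non-compact, $S^j\ne0$ for $1\le j<k$ and $S^k=0$; (3) for $0\le j\le k-1$, $S^j$ is not a compact perturbation of any linear combination of the operators $S^l$, $0\le l\le k-1$, $l\ne j$; (4) $S$ is strictly singular; (5) every bounded linear operator $T$ on $\mathfrak X_k$ can be written $T=\sum_{i=0}^{k-1}\lambda_iS^i+K$ with $\lambda_i\in\mathbb R$ and $K$ compact. $\mathcal L(X)$, $\mathcal K(X)$, $\mathcal{SS}(X)$ denote the bounded, compact and strictly singular operators on $X$. *)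

theory Defs
  imports
    "HOL-Analysis.Abstract_Topological_Spaces"
    "HOL-Analysis.Bounded_Linear_Function"
    "HOL-Algebra.QuotRing"
    "HOL-Algebra.Subrings"
    "Jordan_Normal_Form.VS_Connect"
begin

definition finite_dim :: "'a::real_vector set \<Rightarrow> bool" where
  "finite_dim Y \<longleftrightarrow> (\<exists>B. finite B \<and> Y \<subseteq> Real_Vector_Spaces.span B)"

definition closed_subspace :: "'a::real_normed_vector set \<Rightarrow> bool" where
  "closed_subspace Y \<longleftrightarrow> Real_Vector_Spaces.subspace Y \<and> closed Y"

text \<open>
  A closed subspace is indecomposable if it is not the (topological) direct sum of two
  infinite-dimensional closed subspaces. In a Banach space an algebraic direct sum decomposition
  of a closed subspace into closed subspaces is automatically topological.
\<close>
definition indecomposable :: "'a::banach set \<Rightarrow> bool" where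
  "indecomposable Y \<longleftrightarrow>
    \<not> (\<exists>V W. closed_subspace V \<and> closed_subspace W \<and> \<not> finite_dim V \<and> \<not> finite_dim W \<and>
            V \<inter> W = {0} \<and> {v + w | v w. v \<in> V \<and> w \<in> W} = Y)"

definition hereditarily_indecomposable :: "'a::banach set \<Rightarrow> bool" where
  "hereditarily_indecomposable X \<longleftrightarrow> \<not> finite_dim X \<and>
    (\<forall>Y. closed_subspace Y \<and> \<not> finite_dim Y \<and> Y \<subseteq> X \<longrightarrow> indecomposable Y)"

text \<open>
  \<open>X\<close> is a linear subspace of a normed space, \<open>E\<close> a linear space of real sequences with norm \<open>\<nu>\<close>:
  there is a linear isomorphism \<open>T\<close> of \<open>X\<close> onto \<open>E\<close> whose norm and whose inverse's norm have product
  at most \<open>d\<close>.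
\<close>
definition isomorphic_to_seq_space ::
    "real \<Rightarrow> 'a::real_normed_vector set \<Rightarrow> (nat \<Rightarrow> real) set \<Rightarrow> ((nat \<Rightarrow> real) \<Rightarrow> real) \<Rightarrow> bool" where
  "isomorphic_to_seq_space d X E \<nu> \<longleftrightarrow>
    (\<exists>T A B. bij_betw T X E \<and>
      (\<forall>x\<in>X. \<forall>y\<in>X. \<forall>a b. T (a *\<^sub>R x + b *\<^sub>R y) = (\<lambda>i. a * T x i + b * T y i)) \<and>
      0 \<le> A \<and> (\<forall>x\<in>X. \<nu> (T x) \<le> A * norm x) \<and>
      0 \<le> B \<and> (\<forall>x\<in>X. norm x \<le> B * \<nu> (T x)) \<and>
      A * B \<le> d)"

definition ell1 :: "(nat \<Rightarrow> real) set" where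
  "ell1 = {a. summable (\<lambda>i. \<bar>a i\<bar>)}"

definition ell1_norm :: "(nat \<Rightarrow> real) \<Rightarrow> real" where
  "ell1_norm a = (\<Sum>i. \<bar>a i\<bar>)"

text \<open>The space of \<open>n\<close>-tuples, extended by zero, with the maximum norm.\<close>
definition ell_infty_fin :: "nat \<Rightarrow> (nat \<Rightarrow> real) set" where
  "ell_infty_fin n = {a. \<forall>i\<ge>n. a i = 0}"

definition ell_infty_fin_norm :: "nat \<Rightarrow> (nat \<Rightarrow> real) \<Rightarrow> real" where
  "ell_infty_fin_norm n a = Max (insert 0 ((\<lambda>i. \<bar>a i\<bar>) ` {..<n}))"

text \<open>
  Script-L-infinity spaces in the sense of Lindenstrauss and Pelczynski. The \<open>n\<close> below is
  necessarily the dimension of \<open>F\<close>.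
\<close>
definition script_L_infty_const :: "real \<Rightarrow> 'a::banach set \<Rightarrow> bool" where
  "script_L_infty_const d X \<longleftrightarrow>
    (\<forall>E. Real_Vector_Spaces.subspace E \<and> finite_dim E \<and> E \<subseteq> X \<longrightarrow>
      (\<exists>F n. Real_Vector_Spaces.subspace F \<and> finite_dim F \<and> E \<subseteq> F \<and> F \<subseteq> X \<and>
        isomorphic_to_seq_space d F (ell_infty_fin n) (ell_infty_fin_norm n)))"

definition script_L_infty :: "'a::banach set \<Rightarrow> bool" where
  "script_L_infty X \<longleftrightarrow> (\<exists>d\<ge>1. script_L_infty_const d X)"

definition compact_ops :: "('a::real_normed_vector \<Rightarrow>\<^sub>L 'b::real_normed_vector) set" where
  "compact_ops = {T. compact (closure (blinfun_apply T ` cball 0 1))}"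

definition strictly_singular_ops :: "('a::real_normed_vector \<Rightarrow>\<^sub>L 'b::real_normed_vector) set" where
  "strictly_singular_ops = {T. \<forall>Y. closed_subspace Y \<and> \<not> finite_dim Y \<longrightarrow>
     \<not> (\<exists>c>0. \<forall>x\<in>Y. c * norm x \<le> norm (blinfun_apply T x))}"

text \<open>
  A real algebra is given by a record of type \<open>(real, 'a) module\<close>, with scalar field
  \<open>class_ring :: real ring\<close>.
\<close>

definition op_algebra :: "(real, 'a::real_normed_vector \<Rightarrow>\<^sub>L 'a) module" where
  "op_algebra = \<lparr>carrier = UNIV, mult = (o\<^sub>L), one = id_blinfun, zero = 0, add = (+),
                 smult = (*\<^sub>R)\<rparr>"

definition poly_algebra :: "(real, real poly) module" where
  "poly_algebra = \<lparr>carrier = UNIV, mult = (*), one = 1, zero = 0, add = (+),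
                   smult = Polynomial.smult\<rparr>"

text \<open>
  The scalar multiplication on cosets follows the pattern of \<open>rcoset_mult\<close>: for an ideal \<open>J\<close>,
  it sends \<open>J +> x\<close> to \<open>J +> c \<odot> x\<close>.
\<close>
definition quotient_algebra :: "(real, 'a) module \<Rightarrow> 'a set \<Rightarrow> (real, 'a set) module" where
  "quotient_algebra M J =
    \<lparr>carrier = carrier (M Quot J), mult = mult (M Quot J), one = one (M Quot J),
     zero = zero (M Quot J), add = add (M Quot J),
     smult = (\<lambda>c C. \<Union>x\<in>C. J +>\<^bsub>M\<^esub> (c \<odot>\<^bsub>M\<^esub> x))\<rparr>"

definition calkin_algebra :: "(real, ('a::real_normed_vector \<Rightarrow>\<^sub>L 'a) set) module" where
  "calkin_algebra = quotient_algebra op_algebra compact_ops"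

definition calkin_class :: "('a::real_normed_vector \<Rightarrow>\<^sub>L 'a) \<Rightarrow> ('a \<Rightarrow>\<^sub>L 'a) set" where
  "calkin_class T = compact_ops +>\<^bsub>op_algebra\<^esub> T"

definition alg_iso :: "(real, 'a) module \<Rightarrow> (real, 'b) module \<Rightarrow> ('a \<Rightarrow> 'b) set" where
  "alg_iso M M' = {h \<in> ring_iso M M'.
     \<forall>c. \<forall>x\<in>carrier M. h (c \<odot>\<^bsub>M\<^esub> x) = c \<odot>\<^bsub>M'\<^esub> h x}"

definition is_subalgebra :: "'a set \<Rightarrow> (real, 'a) module \<Rightarrow> bool" where
  "is_subalgebra H M \<longleftrightarrow> subring H M \<and> (\<forall>c. \<forall>x\<in>H. c \<odot>\<^bsub>M\<^esub> x \<in> H)"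

definition generated_subalgebra :: "'a set \<Rightarrow> (real, 'a) module \<Rightarrow> 'a set" where
  "generated_subalgebra B M = \<Inter>{H. is_subalgebra H M \<and> B \<subseteq> H}"

abbreviation mat_algebra :: "nat \<Rightarrow> (real, real mat) module" where
  "mat_algebra k \<equiv> module_mat TYPE(real) k k"

definition shift_mat :: "nat \<Rightarrow> real mat" where
  "shift_mat k = mat k k (\<lambda>(i, j). if j = i + 1 then 1 else 0)"

definition upper_toeplitz :: "nat \<Rightarrow> real mat set" where
  "upper_toeplitz k = {M \<in> carrier_mat k k. upper_triangular M \<and>
     (\<forall>i j. i + 1 < k \<and> j + 1 < k \<longrightarrow> M $$ (i + 1, j + 1) = M $$ (i, j))}"

definition toeplitz_algebra :: "nat \<Rightarrow> (real, real mat) module" where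
  "toeplitz_algebra k = (mat_algebra k)\<lparr>carrier := upper_toeplitz k\<rparr>"

end

theory Submission
  imports Defs
begin

text \<open>
  Every operator \<open>T\<close> has the form \<open>c\<^sub>0 I + c\<^sub>1 S + \<dots> + c\<^sub>k\<^sub>-\<^sub>1 S\<^sup>k\<^sup>-\<^sup>1 + K\<close> with \<open>K\<close> compact, and the independence
  of the powers of \<open>S\<close> modulo the compact operators makes the coefficients unique. Since \<open>S\<^sup>k = 0\<close>,
  composing two operators convolves their coefficients, up to a compact operator. The
  upper-triangular Toeplitz matrices multiply in the same way (\<open>toeplitz_mat_mult\<close>), so sending \<open>T\<close> to
  the Toeplitz matrix of its coefficients (\<open>op_symbol\<close>) is a surjective algebra homomorphism with
  kernel the compact operators, and it induces the isomorphism on the Calkin algebra. Likewise the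
  map from polynomials to Toeplitz matrices has as its kernel the multiples of \<open>X\<^sup>k\<close>. Both quotients are
  covered by \<open>quotient_algebra_iso\<close>. The same uniqueness shows that the classes of the powers of \<open>S\<close>
  form a basis (\<open>calkin_basis\<close>), and that \<open>S\<close> is not a compact perturbation of a scalar.

  For the last inclusion, \<open>T - c\<^sub>0 I\<close> is \<open>R S + K\<close> for a polynomial \<open>R\<close> in \<open>S\<close>. If it were bounded below on
  an infinite-dimensional closed subspace, pass to a smaller one on which \<open>K\<close> is small
  (\<open>compact_op_small_on_subspace\<close>); there \<open>R S\<close> and hence \<open>S\<close> would be bounded below, which strict
  singularity of \<open>S\<close> forbids. The smaller subspace is cut out by finitely many norming functionals,
  which exist by the Hahn-Banach theorem; the functionals are obtained as minimal sublinear
  functions below the norm.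
\<close>

section \<open>Norming functionals\<close>

text \<open>
Real-valued functions that are subadditive and positively homogeneous.
\<close>
definition sublinear :: "('a::real_vector \<Rightarrow> real) \<Rightarrow> bool" where
  "sublinear q \<longleftrightarrow> (\<forall>x y. q (x + y) \<le> q x + q y) \<and> (\<forall>x. \<forall>t\<ge>0. q (t *\<^sub>R x) = t * q x)"

lemma sublinear_ge_neg:
  assumes "sublinear q"
  shows "- q (- x) \<le> q x"
proof -
  have "q (0 *\<^sub>R x) = 0 * q x" using assms unfolding sublinear_def by blast
  moreover have "q (x + - x) \<le> q x + q (- x)" using assms unfolding sublinear_def by blast
  ultimately show ?thesis by simp
qed

text \<open>
  The infimum of \<open>q (x + t *\<^sub>R z) - t * q z\<close> over \<open>t \<ge> 0\<close> is again sublinear. It lies below \<open>q\<close>,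
  and the term with \<open>t = 1\<close> bounds its value at \<open>- z\<close>. So a sublinear function that has none strictly
  below it is odd, hence linear.
\<close>
lemma sublinear_descend:
  fixes q :: "'a::real_vector \<Rightarrow> real"
  assumes q: "sublinear q"
  shows "\<exists>r. sublinear r \<and> (\<forall>x. r x \<le> q x) \<and> r (- z) \<le> - q z"
proof -
  have add: "q (x + y) \<le> q x + q y" for x y using q unfolding sublinear_def by blast
  have scale: "q (t *\<^sub>R x) = t * q x" if "t \<ge> 0" for t x using q that unfolding sublinear_def by blast
  define r where "r x = (INF t\<in>{0..}. q (x + t *\<^sub>R z) - t * q z)" for x
  have lower: "- q (- x) \<le> q (x + t *\<^sub>R z) - t * q z" if "t \<ge> 0" for t x
    using add[of "x + t *\<^sub>R z" "- x"] scale[OF that, of z] by simp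
  have bdd: "bdd_below ((\<lambda>t. q (x + t *\<^sub>R z) - t * q z) ` {0..})" for x
    using lower by (intro bdd_belowI2[where m = "- q (- x)"]) auto
  have le: "r x \<le> q (x + t *\<^sub>R z) - t * q z" if "t \<ge> 0" for x t
    unfolding r_def using that by (intro cINF_lower[OF bdd]) auto
  have ge: "c \<le> r x" if "\<And>t. t \<ge> 0 \<Longrightarrow> c \<le> q (x + t *\<^sub>R z) - t * q z" for c x
    unfolding r_def using that by (intro cINF_greatest) auto
  have r_add: "r (x + y) \<le> r x + r y" for x y
  proof -
    have "r (x + y) - (q (y + s *\<^sub>R z) - s * q z) \<le> r x" if "s \<ge> 0" for s
    proof (rule ge)
      fix t :: real assume "t \<ge> 0"
      then have "r (x + y) \<le> q (x + y + (t + s) *\<^sub>R z) - (t + s) * q z"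
        using that by (intro le) auto
      moreover have "q (x + y + (t + s) *\<^sub>R z) \<le> q (x + t *\<^sub>R z) + q (y + s *\<^sub>R z)"
        using add[of "x + t *\<^sub>R z" "y + s *\<^sub>R z"] by (simp add: algebra_simps)
      ultimately show "r (x + y) - (q (y + s *\<^sub>R z) - s * q z) \<le> q (x + t *\<^sub>R z) - t * q z"
        by (simp add: algebra_simps)
    qed
    then have "r (x + y) - r x \<le> r y" by (intro ge) (auto simp: algebra_simps)
    then show ?thesis by simp
  qed
  have r_scale_le: "r (c *\<^sub>R x) \<le> c * r x" if "c > 0" for c x
  proof -
    have "r (c *\<^sub>R x) / c \<le> r x"
    proof (rule ge)
      fix t :: real assume "t \<ge> 0"
      then have "r (c *\<^sub>R x) \<le> q (c *\<^sub>R x + (c * t) *\<^sub>R z) - (c * t) * q z"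
        using that by (intro le) auto
      also have "\<dots> = c * (q (x + t *\<^sub>R z) - t * q z)"
        using scale[of c "x + t *\<^sub>R z"] that by (simp add: algebra_simps)
      finally show "r (c *\<^sub>R x) / c \<le> q (x + t *\<^sub>R z) - t * q z"
        using that by (simp add: field_simps)
    qed
    then show ?thesis using that by (simp add: field_simps)
  qed
  have q0: "q 0 = 0" using scale[of 0 0] by simp
  have r0: "r 0 = 0"
    using le[of 0 0] ge[of 0 0] q0 scale by (intro antisym) (auto simp: q0)
  have r_scale: "r (c *\<^sub>R x) = c * r x" if "c \<ge> 0" for c x
  proof (cases "c = 0")
    case False
    with that have c: "c > 0" by simp
    have "r (inverse c *\<^sub>R (c *\<^sub>R x)) \<le> inverse c * r (c *\<^sub>R x)"
      using c by (intro r_scale_le) auto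
    then have "c * r x \<le> r (c *\<^sub>R x)" using c by (simp add: field_simps)
    then show ?thesis using r_scale_le[OF c] by (intro antisym)
  qed (simp add: r0)
  have "r (- z) \<le> - q z" using le[of 1 "- z"] q0 by simp
  moreover have "r x \<le> q x" for x using le[of 0 x] by simp
  ultimately show ?thesis using r_add r_scale unfolding sublinear_def by blast
qed

text \<open>
  Zorn's lemma for the reversed pointwise order: the pointwise infimum of a chain is finite because
  \<open>- p (- x) \<le> q x\<close> whenever \<open>q\<close> is sublinear and below \<open>p\<close>.
\<close>
lemma exists_minimal_sublinear:
  fixes p :: "'a::real_vector \<Rightarrow> real"
  assumes p: "sublinear p"
  shows "\<exists>m. sublinear m \<and> (\<forall>x. m x \<le> p x) \<and>
    (\<forall>q. sublinear q \<and> (\<forall>x. q x \<le> m x) \<longrightarrow> q = m)"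
proof -
  define A where "A = {q. sublinear q \<and> (\<forall>x. q x \<le> p x)}"
  define P :: "('a \<Rightarrow> real) \<Rightarrow> ('a \<Rightarrow> real) \<Rightarrow> bool" where "P = (\<lambda>q r. \<forall>x. r x \<le> q x)"
  have "\<exists>m\<in>A. \<forall>a\<in>A. P m a \<longrightarrow> a = m"
  proof (rule predicate_Zorn)
    show "partial_order_on A (relation_of P A)"
      by (rule partial_order_on_relation_ofI) (auto simp: P_def fun_eq_iff intro: order_trans antisym)
  next
    fix C assume C: "C \<in> Chains (relation_of P A)"
    then have CA: "C \<subseteq> A" unfolding Chains_def relation_of_def by auto
    have comp: "P q r \<or> P r q" if "q \<in> C" "r \<in> C" for q r
      using C that unfolding Chains_def relation_of_def by auto
    show "\<exists>u\<in>A. \<forall>a\<in>C. P a u"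
    proof (cases "C = {}")
      case True
      then show ?thesis using p unfolding A_def by auto
    next
      case False
      define u where "u x = (INF q\<in>C. q x)" for x
      have sub: "sublinear q" and qp: "q x \<le> p x" if "q \<in> C" for q x
        using that CA unfolding A_def by auto
      have bdd: "bdd_below ((\<lambda>q. q x) ` C)" for x
      proof (rule bdd_belowI2[where m = "- p (- x)"])
        fix q assume "q \<in> C"
        then show "- p (- x) \<le> q x" using sublinear_ge_neg[OF sub, of q x] qp[of q "- x"] by auto
      qed
      have le: "u x \<le> q x" if "q \<in> C" for q x
        unfolding u_def by (rule cINF_lower[OF bdd that])
      have ge: "c \<le> u x" if "\<And>q. q \<in> C \<Longrightarrow> c \<le> q x" for c x
        unfolding u_def using that False by (intro cINF_greatest) auto
      have "u (x + y) \<le> u x + u y" for x y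
      proof -
        have "u (x + y) - r y \<le> u x" if r: "r \<in> C" for r
        proof (rule ge)
          fix q assume q: "q \<in> C"
          \<comment> \<open>the smaller of the two members of the chain bounds both summands\<close>
          obtain s where s: "s \<in> C" "s x \<le> q x" "s y \<le> r y"
            using comp[OF q r] q r unfolding P_def by blast
          have "s (x + y) \<le> s x + s y" using sub[OF s(1)] unfolding sublinear_def by blast
          then show "u (x + y) - r y \<le> q x" using le[OF s(1), of "x + y"] s by linarith
        qed
        then have "u (x + y) - u x \<le> u y" by (intro ge) (auto simp: algebra_simps)
        then show ?thesis by simp
      qed
      moreover have "u (t *\<^sub>R x) = t * u x" if "t \<ge> 0" for t x
      proof (cases "t = 0")
        case True
        have "q 0 = 0" if "q \<in> C" for q
        proof -
          have "q (0 *\<^sub>R 0) = 0 * q 0" using sub[OF that] unfolding sublinear_def by blast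
          then show ?thesis by simp
        qed
        then have "u 0 = 0"
          using le[of _ 0] ge[of 0 0] \<open>C \<noteq> {}\<close> by (metis all_not_in_conv antisym order_refl)
        then show ?thesis using True by simp
      next
        case False
        with that have t: "t > 0" by simp
        have eq: "q (t *\<^sub>R x) = t * q x" if "q \<in> C" for q
          using sub[OF that] t unfolding sublinear_def by simp
        have "t * u x \<le> u (t *\<^sub>R x)"
          using t le by (intro ge) (auto simp: eq)
        moreover have "u (t *\<^sub>R x) / t \<le> u x"
        proof (rule ge)
          fix q assume "q \<in> C"
          then show "u (t *\<^sub>R x) / t \<le> q x" using le[of q "t *\<^sub>R x"] eq t by (simp add: field_simps)
        qed
        ultimately show ?thesis using t by (simp add: field_simps)
      qed
      moreover have "u x \<le> p x" for x
        using False le qp by (meson ex_in_conv order_trans)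
      ultimately have "u \<in> A" unfolding A_def sublinear_def by blast
      then show ?thesis using le unfolding P_def by blast
    qed
  qed
  then obtain m where m: "sublinear m" "\<And>x. m x \<le> p x" 
    and min: "\<And>a. a \<in> A \<Longrightarrow> P m a \<Longrightarrow> a = m" unfolding A_def by auto
  have "q = m" if "sublinear q" "\<forall>x. q x \<le> m x" for q
    using that m(2) by (intro min) (auto simp: A_def P_def intro: order_trans)
  with m show ?thesis by blast
qed

text \<open>
  The form of the Hahn-Banach theorem needed below. Descending once from the norm in direction \<open>y\<close>
  forces the value \<open>- norm y\<close> at \<open>- y\<close>, and a minimal sublinear function below the result is the
  functional.
\<close>
lemma exists_norming_functional:
  fixes y :: "'a::real_normed_vector"
  shows "\<exists>f. linear f \<and> f y = norm y \<and> (\<forall>x. \<bar>f x\<bar> \<le> norm x)"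
proof -
  have "sublinear (norm :: 'a \<Rightarrow> real)" unfolding sublinear_def by (simp add: norm_triangle_ineq)
  from sublinear_descend[OF this, of y] obtain p where
    p: "sublinear p" "\<And>x. p x \<le> norm x" "p (- y) \<le> - norm y" by blast
  from exists_minimal_sublinear[OF p(1)] obtain f where
    f: "sublinear f" "\<And>x. f x \<le> p x" and min: "\<And>q. sublinear q \<Longrightarrow> (\<forall>x. q x \<le> f x) \<Longrightarrow> q = f" by blast
  have add: "f (x + z) \<le> f x + f z" for x z using f(1) unfolding sublinear_def by blast
  have odd: "f (- z) = - f z" for z
  proof -
    from sublinear_descend[OF f(1), of z] obtain r where
      "sublinear r" "\<forall>x. r x \<le> f x" "r (- z) \<le> - f z" by blast
    then have "f (- z) \<le> - f z" using min by blast
    then show ?thesis using sublinear_ge_neg[OF f(1), of z] by simp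
  qed
  have "linear f"
  proof (rule linearI)
    fix x z
    show "f (x + z) = f x + f z"
      using add[of x z] add[of "- x" "- z"] odd[of "x + z"] by (simp add: odd)
  next
    fix c x
    have pos: "f (t *\<^sub>R x) = t * f x" if "t \<ge> 0" for t using f(1) that unfolding sublinear_def by blast
    show "f (c *\<^sub>R x) = c *\<^sub>R f x"
      using pos[of c] pos[of "- c"] odd[of "c *\<^sub>R x"] by (cases "c \<ge> 0") auto
  qed
  moreover have bound: "\<bar>f x\<bar> \<le> norm x" for x
    using f(2)[of x] p(2)[of x] f(2)[of "- x"] p(2)[of "- x"] odd[of x] by auto
  moreover have "f y = norm y"
    using f(2)[of "- y"] p(3) odd[of y] bound[of y] by auto
  ultimately show ?thesis by blast
qed

section \<open>Compact perturbations of strictly singular operators\<close>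

lemma infinite_dim_Int_kernel:
  fixes f :: "'a::real_vector \<Rightarrow> real"
  assumes Y: "Real_Vector_Spaces.subspace Y" "\<not> finite_dim Y" and f: "linear f"
  shows "\<not> finite_dim {x \<in> Y. f x = 0}"
proof
  assume "finite_dim {x \<in> Y. f x = 0}"
  then obtain B where B: "finite B" "{x \<in> Y. f x = 0} \<subseteq> Real_Vector_Spaces.span B"
    unfolding finite_dim_def by blast
  interpret f: linear f by fact
  show False
  proof (cases "\<forall>x\<in>Y. f x = 0")
    case True
    then have "{x \<in> Y. f x = 0} = Y" by auto
    then show False using B Y(2) unfolding finite_dim_def by auto
  next
    case False
    then obtain y where y: "y \<in> Y" "f y \<noteq> 0" by blast
    have "x \<in> Real_Vector_Spaces.span (insert y B)" if x: "x \<in> Y" for x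
    proof -
      let ?z = "x - (f x / f y) *\<^sub>R y"
      have "?z \<in> {x \<in> Y. f x = 0}"
        using x y Y(1) by (auto simp: f.diff f.scaleR real_vector.subspace_diff real_vector.subspace_scale)
      then have "?z \<in> Real_Vector_Spaces.span (insert y B)"
        using B(2) real_vector.span_mono[of B "insert y B"] by blast
      moreover have "(f x / f y) *\<^sub>R y \<in> Real_Vector_Spaces.span (insert y B)"
        by (simp add: real_vector.span_base real_vector.span_scale)
      ultimately have "?z + (f x / f y) *\<^sub>R y \<in> Real_Vector_Spaces.span (insert y B)"
        by (rule real_vector.span_add)
      then show ?thesis by simp
    qed
    then show False using B(1) Y(2) unfolding finite_dim_def by blast
  qed
qed

lemma infinite_dim_Int_kernels:
  fixes F :: "('a::real_normed_vector \<Rightarrow> real) set"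
  assumes "finite F" "closed_subspace Y" "\<not> finite_dim Y" "\<And>f. f \<in> F \<Longrightarrow> bounded_linear f"
  shows "closed_subspace {x \<in> Y. \<forall>f\<in>F. f x = 0} \<and> \<not> finite_dim {x \<in> Y. \<forall>f\<in>F. f x = 0}"
  using assms
proof (induction F rule: finite_induct)
  case (insert f F)
  let ?Z = "{x \<in> Y. \<forall>f\<in>F. f x = 0}"
  interpret f: bounded_linear f using insert by auto
  have Z: "closed_subspace ?Z" "\<not> finite_dim ?Z" using insert by auto
  have eq: "{x \<in> Y. \<forall>g\<in>insert f F. g x = 0} = {x \<in> ?Z. f x = 0}" by auto
  have "closed (?Z \<inter> {x. f x = 0})"
    using Z(1) unfolding closed_subspace_def
    by (intro closed_Int closed_Collect_eq f.continuous_on continuous_on_id continuous_on_const) auto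
  moreover have "?Z \<inter> {x. f x = 0} = {x \<in> ?Z. f x = 0}" by auto
  moreover have "Real_Vector_Spaces.subspace {x \<in> ?Z. f x = 0}"
    using Z(1) unfolding closed_subspace_def real_vector.subspace_def
    by (auto simp: f.add f.scaleR f.zero)
  moreover have "\<not> finite_dim {x \<in> ?Z. f x = 0}"
    using infinite_dim_Int_kernel[of ?Z f] Z f.linear unfolding closed_subspace_def by auto
  ultimately show ?case unfolding eq closed_subspace_def by simp
qed simp

text \<open>
  A compact operator is arbitrarily small on some infinite-dimensional closed subspace of any
  infinite-dimensional closed subspace. Cover the image of the unit ball by finitely many balls
  of radius \<open>e / 2\<close> and intersect the kernels of the functionals that norm their centres, composed
  with the operator: on this intersection the centre nearest to \<open>K x\<close> itself has norm below \<open>e / 2\<close>.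
\<close>
lemma compact_op_small_on_subspace:
  fixes K :: "'a::real_normed_vector \<Rightarrow>\<^sub>L 'b::real_normed_vector"
  assumes K: "K \<in> compact_ops" and Y: "closed_subspace Y" "\<not> finite_dim Y" and e: "e > 0"
  shows "\<exists>Z\<subseteq>Y. closed_subspace Z \<and> \<not> finite_dim Z \<and>
    (\<forall>x\<in>Z. norm (blinfun_apply K x) \<le> e * norm x)"
proof -
  have "compact (closure (blinfun_apply K ` cball 0 1))" using K unfolding compact_ops_def by simp
  from compactE_image[OF this, of UNIV "\<lambda>y. ball y (e / 2)"] obtain C where
    C: "finite C" "closure (blinfun_apply K ` cball 0 1) \<subseteq> (\<Union>y\<in>C. ball y (e / 2))"
    using e by (metis UNIV_I UN_I centre_in_ball half_gt_zero open_ball subsetI)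
  have "\<forall>y. \<exists>f. linear f \<and> f y = norm y \<and> (\<forall>x::'b. \<bar>f x\<bar> \<le> norm x)"
    using exists_norming_functional by blast
  then obtain f where f: "\<And>y. linear (f y)" "\<And>y. f y y = norm y" "\<And>y x::'b. \<bar>f y x\<bar> \<le> norm x"
    by metis
  have bl: "bounded_linear (\<lambda>x. f y (blinfun_apply K x))" for y
  proof -
    have "bounded_linear (f y)"
      using f(1,3)[of y] by (intro bounded_linear_intro[where K = 1]) (auto simp: linear_add linear_scale)
    then show ?thesis by (rule bounded_linear_compose) (rule blinfun.bounded_linear_right)
  qed
  define Z where "Z = {x \<in> Y. \<forall>g\<in>(\<lambda>y x. f y (blinfun_apply K x)) ` C. g x = 0}"
  have Z: "closed_subspace Z" "\<not> finite_dim Z"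
    using infinite_dim_Int_kernels[OF finite_imageI[OF C(1)] Y, of "\<lambda>y x. f y (blinfun_apply K x)"] bl
    unfolding Z_def by auto
  have "norm (blinfun_apply K x) \<le> e * norm x" if x: "x \<in> Z" for x
  proof (cases "x = 0")
    case False
    let ?u = "blinfun_apply K (x /\<^sub>R norm x)"
    have "?u \<in> closure (blinfun_apply K ` cball 0 1)"
      using False by (intro subsetD[OF closure_subset] imageI) simp
    with C(2) obtain y where y: "y \<in> C" "dist y ?u < e / 2" by auto
    have "f y ?u = 0" using x y(1) unfolding Z_def
      by (simp add: blinfun.scaleR_right linear_scale[OF f(1)])
    then have "norm y = f y (y - ?u)" by (simp add: linear_diff[OF f(1)] f(2))
    also have "\<dots> \<le> dist y ?u" using f(3)[of y "y - ?u"] by (simp add: dist_norm)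
    finally have "norm ?u \<le> e" using y(2) norm_triangle_ineq2[of ?u y]
      by (simp add: dist_norm norm_minus_commute)
    then show ?thesis using False by (simp add: blinfun.scaleR_right field_simps)
  qed (simp add: blinfun.zero_right)
  moreover have "Z \<subseteq> Y" unfolding Z_def by auto
  ultimately show ?thesis using Z by blast
qed

text \<open>
  If \<open>(R o\<^sub>L S) + K\<close> were bounded below by \<open>c\<close> on a subspace, then on a smaller one, where \<open>K\<close> is
  bounded by \<open>c / 2\<close>, the composition and hence \<open>S\<close> would be bounded below.
\<close>
lemma strictly_singular_comp_plus_compact:
  fixes S :: "'a::real_normed_vector \<Rightarrow>\<^sub>L 'b::real_normed_vector"
    and R :: "'b \<Rightarrow>\<^sub>L 'c::real_normed_vector"
  assumes S: "S \<in> strictly_singular_ops" and K: "K \<in> compact_ops"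
  shows "(R o\<^sub>L S) + K \<in> strictly_singular_ops"
proof -
  have False if Y: "closed_subspace Y" "\<not> finite_dim Y" and c: "c > 0"
    and bound: "\<forall>x\<in>Y. c * norm x \<le> norm (blinfun_apply ((R o\<^sub>L S) + K) x)" for Y c
  proof -
    obtain Z where Z: "Z \<subseteq> Y" "closed_subspace Z" "\<not> finite_dim Z"
      and small: "\<forall>x\<in>Z. norm (blinfun_apply K x) \<le> (c / 2) * norm x"
      using compact_op_small_on_subspace[OF K Y, of "c / 2"] c by auto
    define d where "d = c / (2 * (norm R + 1))"
    have d: "d > 0" using c unfolding d_def by (simp add: add_nonneg_pos)
    have "d * norm x \<le> norm (blinfun_apply S x)" if x: "x \<in> Z" for x
    proof -
      have "c * norm x \<le> norm (blinfun_apply R (blinfun_apply S x)) + norm (blinfun_apply K x)"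
      proof -
        have "c * norm x \<le> norm (blinfun_apply R (blinfun_apply S x) + blinfun_apply K x)"
          using bound Z(1) x by (auto simp: blinfun.add_left)
        also have "\<dots> \<le> norm (blinfun_apply R (blinfun_apply S x)) + norm (blinfun_apply K x)"
          by (rule norm_triangle_ineq)
        finally show ?thesis .
      qed
      then have "(c / 2) * norm x \<le> norm (blinfun_apply R (blinfun_apply S x))"
        using bspec[OF small x] by (simp add: algebra_simps)
      also have "\<dots> \<le> norm R * norm (blinfun_apply S x)" by (rule norm_blinfun)
      also have "\<dots> \<le> (norm R + 1) * norm (blinfun_apply S x)" by (simp add: algebra_simps)
      finally show ?thesis unfolding d_def using norm_ge_zero[of R]
        by (simp add: divide_simps add_nonneg_pos) (simp add: algebra_simps)
    qed
    then show False using S Z d unfolding strictly_singular_ops_def by blast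
  qed
  then show ?thesis unfolding strictly_singular_ops_def by blast
qed

section \<open>The ideal of compact operators\<close>

lemma compact_ops_iff:
  "T \<in> compact_ops \<longleftrightarrow> (\<exists>C. compact C \<and> blinfun_apply T ` cball 0 1 \<subseteq> C)"
proof
  assume "\<exists>C. compact C \<and> blinfun_apply T ` cball 0 1 \<subseteq> C"
  then obtain C where C: "compact C" "blinfun_apply T ` cball 0 1 \<subseteq> C" by blast
  then have "closure (blinfun_apply T ` cball 0 1) \<subseteq> C"
    by (simp add: closure_minimal compact_imp_closed)
  then have "compact (C \<inter> closure (blinfun_apply T ` cball 0 1))"
    using C(1) by (intro compact_Int_closed) auto
  then show "T \<in> compact_ops"
    using \<open>closure _ \<subseteq> C\<close> unfolding compact_ops_def by (simp add: Int_absorb1)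
next
  assume "T \<in> compact_ops"
  then show "\<exists>C. compact C \<and> blinfun_apply T ` cball 0 1 \<subseteq> C"
    unfolding compact_ops_def
    by (intro exI[of _ "closure (blinfun_apply T ` cball 0 1)"]) (simp add: closure_subset)
qed

lemma compact_ops_zero: "0 \<in> compact_ops"
  unfolding compact_ops_iff by (intro exI[of _ "{0}"]) auto

lemma compact_ops_add:
  assumes "T \<in> compact_ops" "U \<in> compact_ops"
  shows "T + U \<in> compact_ops"
proof -
  obtain C D where C: "compact C" "blinfun_apply T ` cball 0 1 \<subseteq> C"
    and D: "compact D" "blinfun_apply U ` cball 0 1 \<subseteq> D"
    using assms unfolding compact_ops_iff by blast
  have "blinfun_apply (T + U) ` cball 0 1 \<subseteq> {x + y |x y. x \<in> C \<and> y \<in> D}"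
    using C(2) D(2) unfolding image_subset_iff blinfun.add_left by blast
  with compact_sums[OF C(1) D(1)] show ?thesis
    unfolding compact_ops_iff by (intro exI conjI)
qed

lemma compact_ops_scaleR:
  assumes "T \<in> compact_ops"
  shows "c *\<^sub>R T \<in> compact_ops"
proof -
  obtain C where "compact C" "blinfun_apply T ` cball 0 1 \<subseteq> C"
    using assms unfolding compact_ops_iff by blast
  then show ?thesis
    unfolding compact_ops_iff
    by (intro exI[of _ "(\<lambda>x. c *\<^sub>R x) ` C"]) (auto intro: compact_scaling simp: blinfun.scaleR_left)
qed

lemma compact_ops_diff:
  "T \<in> compact_ops \<Longrightarrow> U \<in> compact_ops \<Longrightarrow> T - U \<in> compact_ops"
  using compact_ops_add[of T "(- 1) *\<^sub>R U"] compact_ops_scaleR[of U "- 1"] by simp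

lemma compact_ops_comp_left:
  assumes "T \<in> compact_ops"
  shows "R o\<^sub>L T \<in> compact_ops"
proof -
  obtain C where "compact C" "blinfun_apply T ` cball 0 1 \<subseteq> C"
    using assms unfolding compact_ops_iff by blast
  then show ?thesis
    unfolding compact_ops_iff
    by (intro exI[of _ "blinfun_apply R ` C"])
       (auto intro!: compact_continuous_image linear_continuous_on blinfun.bounded_linear_right)
qed

lemma compact_ops_comp_right:
  assumes "T \<in> compact_ops"
  shows "T o\<^sub>L R \<in> compact_ops"
proof -
  obtain C where C: "compact C" "blinfun_apply T ` cball 0 1 \<subseteq> C"
    using assms unfolding compact_ops_iff by blast
  define r where "r = norm R + 1"
  have r: "r > 0" unfolding r_def by (simp add: add_nonneg_pos)
  have "blinfun_apply T (blinfun_apply R x) \<in> (\<lambda>x. r *\<^sub>R x) ` C" if "norm x \<le> 1" for x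
  proof -
    have "norm (blinfun_apply R x) \<le> r"
      using norm_blinfun[of R x] mult_left_mono[OF that norm_ge_zero[of R]] unfolding r_def by simp
    then have "blinfun_apply R x /\<^sub>R r \<in> cball 0 1" using r by (simp add: field_simps)
    then have "blinfun_apply T (blinfun_apply R x /\<^sub>R r) \<in> C" using C(2) by blast
    then show ?thesis using r
      by (intro image_eqI[of _ _ "blinfun_apply T (blinfun_apply R x /\<^sub>R r)"])
         (simp_all add: blinfun.scaleR_right)
  qed
  then show ?thesis
    unfolding compact_ops_iff using C(1)
    by (intro exI[of _ "(\<lambda>x. r *\<^sub>R x) ` C"]) (auto intro: compact_scaling)
qed

lemma ring_op_algebra: "ring (op_algebra :: (real, 'a::real_normed_vector \<Rightarrow>\<^sub>L 'a) module)"
proof -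
  have "\<exists>U. U + T = 0 \<and> T + U = 0" for T :: "'a \<Rightarrow>\<^sub>L 'a"
    by (intro exI[of _ "- T"]) simp
  then show ?thesis
    by unfold_locales
       (auto simp: op_algebra_def Units_def blinfun.add_left blinfun.add_right intro!: blinfun_eqI)
qed

lemma op_one [simp]: "\<one>\<^bsub>op_algebra\<^esub> = id_blinfun"
  and op_mult [simp]: "T \<otimes>\<^bsub>op_algebra\<^esub> U = (T o\<^sub>L U)"
  by (simp_all add: op_algebra_def)

lemma ideal_compact_ops:
  "ideal compact_ops (op_algebra :: (real, 'a::real_normed_vector \<Rightarrow>\<^sub>L 'a) module)"
proof (rule idealI[OF ring_op_algebra])
  interpret op: ring "op_algebra :: (real, 'a \<Rightarrow>\<^sub>L 'a) module" by (rule ring_op_algebra)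
  have neg: "\<ominus>\<^bsub>op_algebra\<^esub> T = - T" for T :: "'a \<Rightarrow>\<^sub>L 'a"
    by (rule op.minus_equality) (auto simp: op_algebra_def)
  show "subgroup compact_ops (add_monoid (op_algebra :: (real, 'a \<Rightarrow>\<^sub>L 'a) module))"
  proof (rule op.add.subgroupI)
    show "compact_ops \<noteq> ({} :: ('a \<Rightarrow>\<^sub>L 'a) set)" using compact_ops_zero by blast
    show "\<ominus>\<^bsub>op_algebra\<^esub> T \<in> compact_ops" if "T \<in> compact_ops" for T :: "'a \<Rightarrow>\<^sub>L 'a"
      using compact_ops_scaleR[OF that, of "- 1"] by (simp add: neg)
  qed (auto simp: op_algebra_def compact_ops_add)
qed (auto simp: op_algebra_def compact_ops_comp_left compact_ops_comp_right)

section \<open>Polynomials in a nilpotent operator\<close>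

text \<open>
  The value at \<open>S\<close> of the truncation of \<open>p\<close> below degree \<open>k\<close>. When the \<open>k\<close>-th power of \<open>S\<close> vanishes,
  this is the value of \<open>p\<close> itself, and evaluation is multiplicative. Polynomials are used as
  containers for the first \<open>k\<close> coefficients, so that products are convolutions.
\<close>
definition op_poly :: "nat \<Rightarrow> ('a::real_normed_vector \<Rightarrow>\<^sub>L 'a) \<Rightarrow> real poly \<Rightarrow> 'a \<Rightarrow>\<^sub>L 'a" where
  "op_poly k S p = (\<Sum>i<k. coeff p i *\<^sub>R S [^]\<^bsub>op_algebra\<^esub> i)"

lemma op_pow_0: "(S::'a::real_normed_vector \<Rightarrow>\<^sub>L 'a) [^]\<^bsub>op_algebra\<^esub> (0::nat) = id_blinfun"
  and op_pow_Suc: "S [^]\<^bsub>op_algebra\<^esub> Suc n = S [^]\<^bsub>op_algebra\<^esub> n o\<^sub>L S"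
  by (simp_all add: nat_pow_def op_algebra_def)

lemma op_pow_Suc2: "S [^]\<^bsub>op_algebra\<^esub> Suc n = S o\<^sub>L S [^]\<^bsub>op_algebra\<^esub> n"
proof (induction n)
  case (Suc n)
  have "S [^]\<^bsub>op_algebra\<^esub> Suc (Suc n) = (S o\<^sub>L S [^]\<^bsub>op_algebra\<^esub> n) o\<^sub>L S"
    by (simp only: op_pow_Suc[of S "Suc n"] Suc)
  also have "\<dots> = S o\<^sub>L S [^]\<^bsub>op_algebra\<^esub> Suc n"
    by (rule blinfun_eqI) (simp add: op_pow_Suc)
  finally show ?case .
qed (auto intro: blinfun_eqI)

lemma op_poly_add: "op_poly k S (p + q) = op_poly k S p + op_poly k S q"
  by (simp add: op_poly_def scaleR_add_left sum.distrib)

lemma op_poly_smult: "op_poly k S (Polynomial.smult c p) = c *\<^sub>R op_poly k S p"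
  by (simp add: op_poly_def scaleR_sum_right)

lemma op_poly_diff: "op_poly k S (p - q) = op_poly k S p - op_poly k S q"
  by (simp add: op_poly_def scaleR_diff_left sum_subtractf)

lemma op_poly_one: "k \<ge> 1 \<Longrightarrow> op_poly k S 1 = id_blinfun"
  by (cases k) (simp_all add: op_poly_def sum.lessThan_Suc_shift op_one del: sum.lessThan_Suc)

lemma op_poly_pCons:
  fixes S :: "'a::real_normed_vector \<Rightarrow>\<^sub>L 'a"
  assumes "S [^]\<^bsub>op_algebra\<^esub> k = 0" "k \<ge> 1"
  shows "op_poly k S (pCons a p) = a *\<^sub>R id_blinfun + (S o\<^sub>L op_poly k S p)"
proof -
  obtain m where m: "k = Suc m" using assms(2) by (cases k) auto
  have comp_sum: "S o\<^sub>L (\<Sum>i\<in>A. f i) = (\<Sum>i\<in>A. S o\<^sub>L f i)"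
    for f :: "nat \<Rightarrow> 'a \<Rightarrow>\<^sub>L 'a" and A
    by (rule blinfun_eqI) (simp add: blinfun.sum_left blinfun.sum_right)
  have comp_scale: "S o\<^sub>L (c *\<^sub>R T) = c *\<^sub>R (S o\<^sub>L T)" for c and T :: "'a \<Rightarrow>\<^sub>L 'a"
    by (rule blinfun_eqI) (simp add: blinfun.scaleR_left blinfun.scaleR_right)
  have "op_poly k S (pCons a p) = a *\<^sub>R id_blinfun + (\<Sum>i<m. coeff p i *\<^sub>R S [^]\<^bsub>op_algebra\<^esub> Suc i)"
    by (simp add: op_poly_def m sum.lessThan_Suc_shift op_one del: sum.lessThan_Suc)
  also have "(\<Sum>i<m. coeff p i *\<^sub>R S [^]\<^bsub>op_algebra\<^esub> Suc i) = (\<Sum>i<k. coeff p i *\<^sub>R S [^]\<^bsub>op_algebra\<^esub> Suc i)"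
    using assms(1) by (simp add: m)
  also have "\<dots> = S o\<^sub>L op_poly k S p"
    by (simp only: op_poly_def comp_sum comp_scale op_pow_Suc2)
  finally show ?thesis .
qed

lemma op_poly_mult:
  assumes "S [^]\<^bsub>op_algebra\<^esub> k = 0" "k \<ge> 1"
  shows "op_poly k S (p * q) = op_poly k S p o\<^sub>L op_poly k S q"
proof (induction p)
  case 0
  show ?case by (rule blinfun_eqI) (simp add: op_poly_def)
next
  case (pCons a p)
  have "op_poly k S (pCons a p * q) = a *\<^sub>R op_poly k S q + (S o\<^sub>L op_poly k S (p * q))"
    using op_poly_pCons[OF assms, of 0 "p * q"] by (simp add: op_poly_add op_poly_smult)
  also have "\<dots> = op_poly k S (pCons a p) o\<^sub>L op_poly k S q"
    unfolding pCons.IH op_poly_pCons[OF assms]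
    by (rule blinfun_eqI) (simp add: blinfun.add_left blinfun.scaleR_left)
  finally show ?case .
qed

lemma exists_poly_coeffs: "\<exists>p. \<forall>i<k. coeff p i = (c :: nat \<Rightarrow> real) i"
  by (rule exI[of _ "\<Sum>i<k. Polynomial.monom (c i) i"]) (simp add: coeff_sum)

section \<open>Upper-triangular Toeplitz matrices\<close>

text \<open>
  The upper-triangular Toeplitz matrix whose \<open>d\<close>-th superdiagonal carries the coefficient of degree
  \<open>d\<close>, i.e. the value of the polynomial at the shift matrix.
\<close>
definition toeplitz_mat :: "nat \<Rightarrow> real poly \<Rightarrow> real mat" where
  "toeplitz_mat k p = mat k k (\<lambda>(i, j). if i \<le> j then coeff p (j - i) else 0)"

lemma toeplitz_mat_carrier [simp]: "toeplitz_mat k p \<in> carrier_mat k k"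
  by (simp add: toeplitz_mat_def)

lemma toeplitz_mat_eq_iff: "toeplitz_mat k p = toeplitz_mat k q \<longleftrightarrow> (\<forall>i<k. coeff p i = coeff q i)"
proof
  assume eq: "toeplitz_mat k p = toeplitz_mat k q"
  show "\<forall>i<k. coeff p i = coeff q i"
  proof (intro allI impI)
    fix i assume "i < k"
    then show "coeff p i = coeff q i" using arg_cong[OF eq, of "\<lambda>M. M $$ (0, i)"]
      by (simp add: toeplitz_mat_def)
  qed
qed (auto simp: toeplitz_mat_def intro!: eq_matI)

lemma toeplitz_mat_0: "toeplitz_mat k 0 = 0\<^sub>m k k"
  by (rule eq_matI) (auto simp: toeplitz_mat_def)

lemma toeplitz_mat_1: "toeplitz_mat k 1 = 1\<^sub>m k"
  by (rule eq_matI) (auto simp: toeplitz_mat_def)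

lemma toeplitz_mat_add: "toeplitz_mat k (p + q) = toeplitz_mat k p + toeplitz_mat k q"
  by (rule eq_matI) (auto simp: toeplitz_mat_def)

lemma toeplitz_mat_smult: "toeplitz_mat k (Polynomial.smult c p) = c \<cdot>\<^sub>m toeplitz_mat k p"
  by (rule eq_matI) (auto simp: toeplitz_mat_def)

lemma toeplitz_mat_mult: "toeplitz_mat k (p * q) = toeplitz_mat k p * toeplitz_mat k q"
proof (rule eq_matI)
  fix i j assume "i < dim_row (toeplitz_mat k p * toeplitz_mat k q)"
    "j < dim_col (toeplitz_mat k p * toeplitz_mat k q)"
  then have ij: "i < k" "j < k" by (simp_all add: toeplitz_mat_def)
  have "(toeplitz_mat k p * toeplitz_mat k q) $$ (i, j)
      = (\<Sum>l<k. (if i \<le> l then coeff p (l - i) else 0) * (if l \<le> j then coeff q (j - l) else 0))"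
    using ij by (simp add: toeplitz_mat_def scalar_prod_def atLeast0LessThan)
  also have "\<dots> = (\<Sum>l\<in>{i..j}. coeff p (l - i) * coeff q (j - l))"
    using ij by (intro sum.mono_neutral_cong_right) auto
  also have "\<dots> = (if i \<le> j then coeff (p * q) (j - i) else 0)"
  proof (cases "i \<le> j")
    case True
    have "(\<Sum>l\<in>{i..j}. coeff p (l - i) * coeff q (j - l))
        = (\<Sum>m\<le>j - i. coeff p m * coeff q (j - i - m))"
      using True by (intro sum.reindex_bij_witness[of _ "\<lambda>m. m + i" "\<lambda>l. l - i"]) auto
    then show ?thesis using True by (simp add: coeff_mult)
  qed simp
  finally show "toeplitz_mat k (p * q) $$ (i, j) = (toeplitz_mat k p * toeplitz_mat k q) $$ (i, j)"
    using ij by (simp add: toeplitz_mat_def)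
qed (simp_all add: toeplitz_mat_def)

lemma toeplitz_mat_X: "toeplitz_mat k (Polynomial.monom 1 1) = shift_mat k"
  by (rule eq_matI) (auto simp: toeplitz_mat_def shift_mat_def)

lemma range_toeplitz_mat: "range (toeplitz_mat k) = upper_toeplitz k"
proof
  show "range (toeplitz_mat k) \<subseteq> upper_toeplitz k"
    by (auto simp: upper_toeplitz_def upper_triangular_def toeplitz_mat_def)
next
  show "upper_toeplitz k \<subseteq> range (toeplitz_mat k)"
  proof
    fix M assume M: "M \<in> upper_toeplitz k"
    then have diag: "M $$ (i + 1, j + 1) = M $$ (i, j)" if "i + 1 < k" "j + 1 < k" for i j
      using that unfolding upper_toeplitz_def by blast
    have shift: "M $$ (i, i + d) = M $$ (0, d)" if "i + d < k" for i d
      using that by (induction i) (use diag in auto)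
    obtain p where p: "\<forall>i<k. coeff p i = M $$ (0, i)" 
      using exists_poly_coeffs[of k "\<lambda>i. M $$ (0, i)"] by blast
    have "M = toeplitz_mat k p"
    proof (rule eq_matI)
      fix i j assume "i < dim_row (toeplitz_mat k p)" "j < dim_col (toeplitz_mat k p)"
      then have ij: "i < k" "j < k" by (simp_all add: toeplitz_mat_def)
      show "M $$ (i, j) = toeplitz_mat k p $$ (i, j)"
      proof (cases "i \<le> j")
        case True
        then show ?thesis using ij p shift[of i "j - i"] by (simp add: toeplitz_mat_def)
      next
        case False
        then show ?thesis using ij M
          by (auto simp: toeplitz_mat_def upper_toeplitz_def upper_triangular_def)
      qed
    qed (use M in \<open>auto simp: toeplitz_mat_def upper_toeplitz_def\<close>)
    then show "M \<in> range (toeplitz_mat k)" by blast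
  qed
qed

lemma ring_mat_algebra: "ring (mat_algebra k)"
proof -
  interpret R: ring "ring_mat TYPE(real) k ()" by (rule ring_mat)
  interpret G: abelian_group "mat_algebra k" by (rule abelian_group_mat)
  show ?thesis
    by unfold_locales
      (auto simp: module_mat_simps add_mult_distrib_mat mult_add_distrib_mat assoc_mult_mat)
qed

lemma ring_poly_algebra: "ring poly_algebra"
proof -
  have "\<exists>q. q + p = 0 \<and> p + q = 0" for p :: "real poly"
    by (intro exI[of _ "- p"]) simp
  then show ?thesis
    by unfold_locales (auto simp: poly_algebra_def Units_def algebra_simps)
qed

lemma toeplitz_mat_hom: "ring_hom_ring poly_algebra (mat_algebra k) (toeplitz_mat k)"
  by (rule ring_hom_ringI2[OF ring_poly_algebra ring_mat_algebra], rule ring_hom_memI)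
     (auto simp: poly_algebra_def module_mat_simps toeplitz_mat_mult toeplitz_mat_add toeplitz_mat_1)

lemma is_subalgebra_upper_toeplitz: "is_subalgebra (upper_toeplitz k) (mat_algebra k)"
proof -
  interpret ring_hom_ring poly_algebra "mat_algebra k" "toeplitz_mat k" by (rule toeplitz_mat_hom)
  have "subring (toeplitz_mat k ` carrier poly_algebra) (mat_algebra k)"
    by (rule img_is_subring) (rule R.carrier_is_subring)
  then have "subring (upper_toeplitz k) (mat_algebra k)"
    by (simp add: poly_algebra_def range_toeplitz_mat)
  moreover have "c \<cdot>\<^sub>m M \<in> upper_toeplitz k" if "M \<in> upper_toeplitz k" for c M
    using that unfolding range_toeplitz_mat[symmetric]
    by (auto simp: toeplitz_mat_smult[symmetric])
  ultimately show ?thesis unfolding is_subalgebra_def by (simp add: module_mat_simps)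
qed

lemma ring_toeplitz_algebra: "ring (toeplitz_algebra k)"
  using ring.subring_is_ring[OF ring_mat_algebra] is_subalgebra_upper_toeplitz[of k]
  by (simp add: toeplitz_algebra_def is_subalgebra_def)

lemma shift_mat_pow: "shift_mat k [^]\<^bsub>mat_algebra k\<^esub> j = toeplitz_mat k (Polynomial.monom 1 j)"
proof (induction j)
  case 0
  show ?case by (simp add: nat_pow_def module_mat_simps toeplitz_mat_1)
next
  case (Suc j)
  have "shift_mat k [^]\<^bsub>mat_algebra k\<^esub> Suc j = toeplitz_mat k (Polynomial.monom 1 j) * shift_mat k"
    using Suc by (simp add: nat_pow_def module_mat_simps)
  then show ?case
    by (simp add: toeplitz_mat_X[symmetric] toeplitz_mat_mult[symmetric] mult_monom)
qed

lemma finsum_toeplitz_mat: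
  assumes "finite A"
  shows "(\<Oplus>\<^bsub>mat_algebra k\<^esub>j\<in>A. toeplitz_mat k (f j)) = toeplitz_mat k (\<Sum>j\<in>A. f j)"
proof -
  interpret ring "mat_algebra k" by (rule ring_mat_algebra)
  show ?thesis
    using assms by (induction A) (auto simp: module_mat_simps toeplitz_mat_0 toeplitz_mat_add)
qed

lemma toeplitz_mat_expansion:
  "toeplitz_mat k p = (\<Oplus>\<^bsub>mat_algebra k\<^esub>j\<in>{..<k}.
     coeff p j \<odot>\<^bsub>mat_algebra k\<^esub> (shift_mat k [^]\<^bsub>mat_algebra k\<^esub> j))"
proof -
  have "(\<Oplus>\<^bsub>mat_algebra k\<^esub>j\<in>{..<k}.
      coeff p j \<odot>\<^bsub>mat_algebra k\<^esub> (shift_mat k [^]\<^bsub>mat_algebra k\<^esub> j))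
      = toeplitz_mat k (\<Sum>j<k. Polynomial.smult (coeff p j) (Polynomial.monom 1 j))"
    by (simp only: shift_mat_pow module_mat_simps toeplitz_mat_smult[symmetric]
        finsum_toeplitz_mat[OF finite_lessThan])
  then show ?thesis by (simp add: toeplitz_mat_eq_iff coeff_sum smult_monom)
qed

lemma subalgebra_finsum_closed:
  assumes "ring M" "is_subalgebra H M" "\<And>i. i \<in> A \<Longrightarrow> f i \<in> H"
  shows "(\<Oplus>\<^bsub>M\<^esub>i\<in>A. c i \<odot>\<^bsub>M\<^esub> f i) \<in> H"
proof -
  interpret ring M by fact
  have H: "subring H M" and smult: "\<And>c x. x \<in> H \<Longrightarrow> c \<odot>\<^bsub>M\<^esub> x \<in> H"
    using assms(2) unfolding is_subalgebra_def by auto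
  show ?thesis
    using assms(3)
  proof (induction A rule: infinite_finite_induct)
    case (insert i A)
    have sub: "x \<in> carrier M" if "x \<in> H" for x using that H subringE(1) by blast
    have "(\<Oplus>\<^bsub>M\<^esub>i\<in>insert i A. c i \<odot>\<^bsub>M\<^esub> f i) = c i \<odot>\<^bsub>M\<^esub> f i \<oplus>\<^bsub>M\<^esub> (\<Oplus>\<^bsub>M\<^esub>i\<in>A. c i \<odot>\<^bsub>M\<^esub> f i)"
      using insert by (intro finsum_insert) (auto intro!: sub smult)
    then show ?case using insert smult subringE(7)[OF H] by simp
  qed (use subringE(2)[OF H] in auto)
qed

lemma upper_toeplitz_generated:
  "upper_toeplitz k = generated_subalgebra
     ((\<lambda>j::nat. shift_mat k [^]\<^bsub>mat_algebra k\<^esub> j) ` {..<k}) (mat_algebra k)"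
proof -
  let ?B = "(\<lambda>j::nat. shift_mat k [^]\<^bsub>mat_algebra k\<^esub> j) ` {..<k}"
  have "?B \<subseteq> upper_toeplitz k"
    by (auto simp: shift_mat_pow range_toeplitz_mat[symmetric])
  moreover have "upper_toeplitz k \<subseteq> H" if H: "is_subalgebra H (mat_algebra k)" "?B \<subseteq> H" for H
  proof
    fix M assume "M \<in> upper_toeplitz k"
    then obtain p where "M = toeplitz_mat k p" unfolding range_toeplitz_mat[symmetric] by blast
    then show "M \<in> H" using H(2) toeplitz_mat_expansion[of k p]
        subalgebra_finsum_closed[OF ring_mat_algebra H(1), of "{..<k}" "\<lambda>j. shift_mat k [^]\<^bsub>mat_algebra k\<^esub> j"
          "coeff p"]
      by auto
  qed
  ultimately show ?thesis
    using is_subalgebra_upper_toeplitz unfolding generated_subalgebra_def by blast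
qed

section \<open>Quotient algebras\<close>

lemma ring_quotient_algebra:
  assumes "ideal J M"
  shows "ring (quotient_algebra M J)"
proof -
  interpret Q: ring "M Quot J" by (rule ideal.quotient_is_ring[OF assms])
  show ?thesis
  proof (intro ringI abelian_groupI monoidI)
    show "\<exists>y\<in>carrier (quotient_algebra M J). y \<oplus>\<^bsub>quotient_algebra M J\<^esub> x = \<zero>\<^bsub>quotient_algebra M J\<^esub>"
      if "x \<in> carrier (quotient_algebra M J)" for x
      using that Q.l_neg Q.a_inv_closed by (auto simp: quotient_algebra_def intro!: bexI)
  qed (simp_all add: quotient_algebra_def Q.a_assoc Q.a_comm Q.a_lcomm Q.m_assoc Q.l_distr Q.r_distr)
qed

text \<open>
  The homomorphism theorem for the quotient by the kernel, with the scalar multiplication of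
  cosets. The third part says that the scalar multiplication is well defined.
\<close>
lemma quotient_algebra_iso:
  assumes hom: "ring_hom_ring M M' h"
    and surj: "h ` carrier M = carrier M'"
    and closed: "\<And>c x. x \<in> carrier M \<Longrightarrow> c \<odot>\<^bsub>M\<^esub> x \<in> carrier M"
    and smult: "\<And>c x. x \<in> carrier M \<Longrightarrow> h (c \<odot>\<^bsub>M\<^esub> x) = c \<odot>\<^bsub>M'\<^esub> h x"
    and ker: "J = a_kernel M M' h"
  shows "(\<lambda>C. the_elem (h ` C)) \<in> alg_iso (quotient_algebra M J) M'"
    and "\<And>x. x \<in> carrier M \<Longrightarrow> the_elem (h ` (J +>\<^bsub>M\<^esub> x)) = h x"
    and "\<And>c x. x \<in> carrier M \<Longrightarrow>
      c \<odot>\<^bsub>quotient_algebra M J\<^esub> (J +>\<^bsub>M\<^esub> x) = J +>\<^bsub>M\<^esub> (c \<odot>\<^bsub>M\<^esub> x)"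
proof -
  interpret ring_hom_ring M M' h by fact
  have J: "ideal J M" using kernel_is_ideal ker by simp
  interpret J: ideal J M by fact
  show val: "the_elem (h ` (J +>\<^bsub>M\<^esub> x)) = h x" if "x \<in> carrier M" for x
    using the_elem_simp[OF that] ker by simp
  show sm: "c \<odot>\<^bsub>quotient_algebra M J\<^esub> (J +>\<^bsub>M\<^esub> x) = J +>\<^bsub>M\<^esub> (c \<odot>\<^bsub>M\<^esub> x)"
    if x: "x \<in> carrier M" for c x
  proof -
    have "J +>\<^bsub>M\<^esub> (c \<odot>\<^bsub>M\<^esub> y) = J +>\<^bsub>M\<^esub> (c \<odot>\<^bsub>M\<^esub> x)" if y: "y \<in> J +>\<^bsub>M\<^esub> x" for y
    proof -
      have yc: "y \<in> carrier M" using J.a_elemrcos_carrier[OF x y] .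
      have "J +>\<^bsub>M\<^esub> y = J +>\<^bsub>M\<^esub> x"
        using J.a_repr_independence'[OF y x] by simp
      then have "h y = h x" using val[OF yc] val[OF x] by simp
      then have "h (c \<odot>\<^bsub>M\<^esub> y) = h (c \<odot>\<^bsub>M\<^esub> x)" by (simp add: smult x yc)
      then show ?thesis unfolding ker
        by (intro the_elem_inj) (auto simp: FactRing_def A_RCOSETS_def' closed x yc)
    qed
    with J.a_rcos_self[OF x] have "(\<Union>y\<in>J +>\<^bsub>M\<^esub> x. J +>\<^bsub>M\<^esub> (c \<odot>\<^bsub>M\<^esub> y)) = J +>\<^bsub>M\<^esub> (c \<odot>\<^bsub>M\<^esub> x)"
      by (intro UN_constant_eq) blast+
    then show ?thesis by (simp add: quotient_algebra_def)
  qed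
  have iso: "(\<lambda>C. the_elem (h ` C)) \<in> ring_iso (M Quot J) M'"
    using FactRing_iso_set_aux surj ker by simp
  have "(\<lambda>C. the_elem (h ` C)) \<in> ring_iso (quotient_algebra M J) M'"
    using ring_iso_memE[OF iso] by (intro ring_iso_memI) (simp_all add: quotient_algebra_def)
  moreover have "the_elem (h ` (c \<odot>\<^bsub>quotient_algebra M J\<^esub> C)) = c \<odot>\<^bsub>M'\<^esub> the_elem (h ` C)"
    if C: "C \<in> carrier (quotient_algebra M J)" for c C
  proof -
    obtain x where x: "x \<in> carrier M" "C = J +>\<^bsub>M\<^esub> x"
      using C unfolding quotient_algebra_def FactRing_def A_RCOSETS_def' by auto
    then show ?thesis by (simp add: sm val closed smult)
  qed
  ultimately show "(\<lambda>C. the_elem (h ` C)) \<in> alg_iso (quotient_algebra M J) M'"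
    unfolding alg_iso_def by simp
qed

lemma alg_iso_inverse:
  assumes "ring M" and h: "h \<in> alg_iso M M'"
    and closed: "\<And>c x. x \<in> carrier M \<Longrightarrow> c \<odot>\<^bsub>M\<^esub> x \<in> carrier M"
  shows "inv_into (carrier M) h \<in> alg_iso M' M"
proof -
  have iso: "h \<in> ring_iso M M'"
    and smult: "\<And>c x. x \<in> carrier M \<Longrightarrow> h (c \<odot>\<^bsub>M\<^esub> x) = c \<odot>\<^bsub>M'\<^esub> h x"
    using h unfolding alg_iso_def by auto
  have bij: "bij_betw h (carrier M) (carrier M')" using iso unfolding ring_iso_def by simp
  have "inv_into (carrier M) h (c \<odot>\<^bsub>M'\<^esub> y) = c \<odot>\<^bsub>M\<^esub> inv_into (carrier M) h y"
    if y: "y \<in> carrier M'" for c y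
  proof -
    obtain x where x: "x \<in> carrier M" "y = h x"
      using y bij_betw_imp_surj_on[OF bij] by blast
    show ?thesis
      using bij_betw_inv_into_left[OF bij closed[OF x(1), of c]]
      by (simp add: x(2) smult[OF x(1), symmetric] bij_betw_inv_into_left[OF bij x(1)])
  qed
  then show ?thesis unfolding alg_iso_def using ring_iso_set_sym[OF assms(1) iso] by simp
qed

lemma toeplitz_algebra_iso_quotient:
  "alg_iso (toeplitz_algebra k)
    (quotient_algebra poly_algebra (PIdl\<^bsub>poly_algebra\<^esub> (Polynomial.monom 1 k))) \<noteq> {}"
proof -
  let ?J = "PIdl\<^bsub>poly_algebra\<^esub> (Polynomial.monom 1 k)"
  interpret R: ring poly_algebra by (rule ring_poly_algebra)
  have J: "?J = a_kernel poly_algebra (toeplitz_algebra k) (toeplitz_mat k)"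
  proof -
    have "?J = {p. Polynomial.monom 1 k dvd p}"
      unfolding cgenideal_def by (auto simp: poly_algebra_def dvd_def mult.commute)
    also have "\<dots> = {p. toeplitz_mat k p = toeplitz_mat k 0}"
      by (simp add: toeplitz_mat_eq_iff monom_1_dvd_iff')
    finally show ?thesis
      by (simp add: a_kernel_def' toeplitz_algebra_def module_mat_simps poly_algebra_def toeplitz_mat_0)
  qed
  have hom: "ring_hom_ring poly_algebra (toeplitz_algebra k) (toeplitz_mat k)"
    by (rule ring_hom_ringI2[OF ring_poly_algebra ring_toeplitz_algebra], rule ring_hom_memI)
       (auto simp: poly_algebra_def toeplitz_algebra_def module_mat_simps toeplitz_mat_mult
         toeplitz_mat_add toeplitz_mat_1 range_toeplitz_mat[symmetric])
  have closed: "c \<odot>\<^bsub>poly_algebra\<^esub> p \<in> carrier poly_algebra" for c p by (simp add: poly_algebra_def)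
  note iso = quotient_algebra_iso[OF hom _ closed _ J]
  have surj: "toeplitz_mat k ` carrier poly_algebra = carrier (toeplitz_algebra k)"
    by (simp add: poly_algebra_def toeplitz_algebra_def range_toeplitz_mat)
  have smult: "toeplitz_mat k (c \<odot>\<^bsub>poly_algebra\<^esub> p) = c \<odot>\<^bsub>toeplitz_algebra k\<^esub> toeplitz_mat k p" for c p
    by (simp add: poly_algebra_def toeplitz_algebra_def module_mat_simps toeplitz_mat_smult)
  interpret hom: ring_hom_ring poly_algebra "toeplitz_algebra k" "toeplitz_mat k" by (rule hom)
  have ideal: "ideal ?J poly_algebra" using hom.kernel_is_ideal J by simp
  have "ring (quotient_algebra poly_algebra ?J)"
    by (rule ring_quotient_algebra[OF ideal])
  moreover have "c \<odot>\<^bsub>quotient_algebra poly_algebra ?J\<^esub> C \<in> carrier (quotient_algebra poly_algebra ?J)"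
    if C: "C \<in> carrier (quotient_algebra poly_algebra ?J)" for c C
  proof -
    obtain p where p: "p \<in> carrier poly_algebra" "C = ?J +>\<^bsub>poly_algebra\<^esub> p"
      using C unfolding quotient_algebra_def FactRing_def A_RCOSETS_def' by auto
    have "c \<odot>\<^bsub>quotient_algebra poly_algebra ?J\<^esub> C = ?J +>\<^bsub>poly_algebra\<^esub> (c \<odot>\<^bsub>poly_algebra\<^esub> p)"
      unfolding p(2) by (rule iso(3)[OF surj smult p(1)])
    then show ?thesis using closed
      unfolding quotient_algebra_def FactRing_def A_RCOSETS_def' by auto
  qed
  ultimately show ?thesis using alg_iso_inverse[OF _ iso(1)[OF surj smult]] by blast
qed

section \<open>The Calkin algebra\<close>

lemma calkin_carrier: "carrier calkin_algebra = range calkin_class"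
  by (auto simp: calkin_algebra_def quotient_algebra_def FactRing_def A_RCOSETS_def' calkin_class_def
      op_algebra_def)

lemma calkin_class_eq: "calkin_class T = {V. V - T \<in> compact_ops}"
  unfolding calkin_class_def a_r_coset_def' op_algebra_def by (force simp: algebra_simps)

lemma calkin_class_eq_iff: "calkin_class T = calkin_class U \<longleftrightarrow> T - U \<in> compact_ops"
proof
  assume eq: "calkin_class T = calkin_class U"
  have "T \<in> calkin_class T" by (simp add: calkin_class_eq compact_ops_zero)
  then show "T - U \<in> compact_ops" unfolding eq by (simp add: calkin_class_eq)
next
  assume TU: "T - U \<in> compact_ops"
  have "V - U \<in> compact_ops \<longleftrightarrow> V - T \<in> compact_ops" for V
    using compact_ops_add[of "V - T", OF _ TU] compact_ops_diff[of "V - U", OF _ TU] by auto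
  then show "calkin_class T = calkin_class U" by (simp add: calkin_class_eq)
qed

lemma calkin_class_add:
  "calkin_class T \<oplus>\<^bsub>calkin_algebra\<^esub> calkin_class U = calkin_class (T + U)"
  using ring_hom_add[OF ideal.rcos_ring_hom[OF ideal_compact_ops], of T U]
  by (simp add: calkin_algebra_def quotient_algebra_def calkin_class_def) (simp add: op_algebra_def)

lemma calkin_zero: "\<zero>\<^bsub>calkin_algebra\<^esub> = calkin_class 0"
  by (simp add: calkin_algebra_def quotient_algebra_def FactRing_def calkin_class_eq)

lemma ring_calkin_algebra: "ring calkin_algebra"
  unfolding calkin_algebra_def by (rule ring_quotient_algebra[OF ideal_compact_ops])

lemma calkin_class_smult:
  "c \<odot>\<^bsub>calkin_algebra\<^esub> calkin_class T = calkin_class (c *\<^sub>R T)"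
proof -
  have "calkin_class (c *\<^sub>R U) = calkin_class (c *\<^sub>R T)" if "U \<in> calkin_class T" for U
    using compact_ops_scaleR[of "U - T" c] that
    by (simp add: calkin_class_eq_iff scaleR_diff_right) (simp add: calkin_class_eq)
  moreover have "T \<in> calkin_class T" by (simp add: calkin_class_eq compact_ops_zero)
  ultimately have "(\<Union>U\<in>calkin_class T. calkin_class (c *\<^sub>R U)) = calkin_class (c *\<^sub>R T)"
    by (intro UN_constant_eq) blast+
  moreover have "c \<odot>\<^bsub>calkin_algebra\<^esub> calkin_class T = (\<Union>U\<in>calkin_class T. calkin_class (c *\<^sub>R U))"
    by (simp add: calkin_algebra_def quotient_algebra_def calkin_class_def) (simp add: op_algebra_def)
  ultimately show ?thesis by (rule trans[rotated])
qed

lemma vectorspace_calkin_algebra: "vectorspace class_ring calkin_algebra"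
proof (rule vectorspace.intro)
  interpret Q: ring calkin_algebra by (rule ring_calkin_algebra)
  show "Module.module class_ring calkin_algebra"
    by (rule moduleI[OF class_cring.is_cring Q.is_abelian_group])
       (auto simp: calkin_carrier calkin_class_add calkin_class_smult algebra_simps)
  show "field (class_ring :: real ring)" by (rule class_field)
qed

lemma calkin_finsum:
  assumes "finite A"
  shows "(\<Oplus>\<^bsub>calkin_algebra\<^esub>j\<in>A. calkin_class (f j)) = calkin_class (\<Sum>j\<in>A. f j)"
proof -
  interpret ring calkin_algebra by (rule ring_calkin_algebra)
  show ?thesis
    using assms
    by (induction A) (auto simp: calkin_zero calkin_class_add calkin_carrier)
qed

text \<open>
  Every operator is, up to a compact one, a polynomial of degree below \<open>k\<close> in the operator \<open>S\<close>,
  whose \<open>k\<close>-th power vanishes, and the coefficients are unique.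
\<close>
locale polynomial_calkin =
  fixes k :: nat and S :: "'a::banach \<Rightarrow>\<^sub>L 'a"
  assumes k_pos: "k \<ge> 1"
    and nilpotent: "S [^]\<^bsub>op_algebra\<^esub> k = 0"
    and independent: "\<And>p. op_poly k S p \<in> compact_ops \<Longrightarrow> \<forall>i<k. coeff p i = 0"
    and all_ops: "\<And>T. \<exists>p. T - op_poly k S p \<in> compact_ops"
begin

lemma op_poly_compact_iff: "op_poly k S p \<in> compact_ops \<longleftrightarrow> (\<forall>i<k. coeff p i = 0)"
proof
  assume "\<forall>i<k. coeff p i = 0"
  then have "op_poly k S p = 0" by (simp add: op_poly_def)
  then show "op_poly k S p \<in> compact_ops" by (simp add: compact_ops_zero)
qed (rule independent)

text \<open>
  The Toeplitz matrix of the coefficients of an operator modulo the compact operators. Different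
  choices of the polynomial agree below degree \<open>k\<close>, so they give the same matrix.
\<close>
definition op_symbol :: "('a \<Rightarrow>\<^sub>L 'a) \<Rightarrow> real mat" where
  "op_symbol T = toeplitz_mat k (SOME p. T - op_poly k S p \<in> compact_ops)"

lemma op_symbol_eqI:
  assumes "T - op_poly k S p \<in> compact_ops"
  shows "op_symbol T = toeplitz_mat k p"
proof -
  define q where "q = (SOME p. T - op_poly k S p \<in> compact_ops)"
  have "T - op_poly k S q \<in> compact_ops" unfolding q_def 
    by (rule someI[of "\<lambda>p. T - op_poly k S p \<in> compact_ops", OF assms])
  then have "(T - op_poly k S q) - (T - op_poly k S p) \<in> compact_ops"
    using assms by (rule compact_ops_diff)
  then have "op_poly k S (p - q) \<in> compact_ops" by (simp add: op_poly_diff)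
  then show ?thesis
    unfolding op_symbol_def q_def[symmetric] toeplitz_mat_eq_iff op_poly_compact_iff by simp
qed

lemma op_symbol_op_poly: "op_symbol (op_poly k S p) = toeplitz_mat k p"
  by (rule op_symbol_eqI) (simp add: compact_ops_zero)

lemma op_symbol_scaleR: "op_symbol (c *\<^sub>R T) = c \<cdot>\<^sub>m op_symbol T"
proof -
  obtain p where p: "T - op_poly k S p \<in> compact_ops" using all_ops by blast
  have "op_symbol (c *\<^sub>R T) = toeplitz_mat k (Polynomial.smult c p)"
    using compact_ops_scaleR[OF p, of c]
    by (intro op_symbol_eqI) (simp add: op_poly_smult scaleR_diff_right)
  then show ?thesis by (simp add: op_symbol_eqI[OF p] toeplitz_mat_smult)
qed

lemma op_symbol_add: "op_symbol (T + U) = op_symbol T + op_symbol U"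
proof -
  obtain p q where p: "T - op_poly k S p \<in> compact_ops" and q: "U - op_poly k S q \<in> compact_ops"
    using all_ops by blast
  have "op_symbol (T + U) = toeplitz_mat k (p + q)"
    using compact_ops_add[OF p q]
    by (intro op_symbol_eqI) (simp add: op_poly_add algebra_simps)
  then show ?thesis by (simp add: op_symbol_eqI[OF p] op_symbol_eqI[OF q] toeplitz_mat_add)
qed

lemma op_symbol_comp: "op_symbol (T o\<^sub>L U) = op_symbol T * op_symbol U"
proof -
  obtain p q where p: "T - op_poly k S p \<in> compact_ops" and q: "U - op_poly k S q \<in> compact_ops"
    using all_ops by blast
  have "(T o\<^sub>L U) - op_poly k S (p * q)
      = ((T - op_poly k S p) o\<^sub>L U) + (op_poly k S p o\<^sub>L (U - op_poly k S q))"
    unfolding op_poly_mult[OF nilpotent k_pos]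
    by (rule blinfun_eqI) (simp add: blinfun.add_left blinfun.diff_left blinfun.diff_right)
  also have "\<dots> \<in> compact_ops"
    by (intro compact_ops_add compact_ops_comp_right compact_ops_comp_left p q)
  finally have "op_symbol (T o\<^sub>L U) = toeplitz_mat k (p * q)" by (rule op_symbol_eqI)
  then show ?thesis by (simp add: op_symbol_eqI[OF p] op_symbol_eqI[OF q] toeplitz_mat_mult)
qed

lemma range_op_symbol: "range op_symbol = upper_toeplitz k"
proof -
  have "op_symbol T \<in> range (toeplitz_mat k)" for T unfolding op_symbol_def by blast
  moreover have "toeplitz_mat k p \<in> range op_symbol" for p
    using op_symbol_op_poly[of p] by (metis rangeI)
  ultimately show ?thesis unfolding range_toeplitz_mat[symmetric] by blast
qed

lemma op_symbol_hom: "ring_hom_ring op_algebra (toeplitz_algebra k) op_symbol"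
proof (rule ring_hom_ringI2[OF ring_op_algebra ring_toeplitz_algebra], rule ring_hom_memI)
  show "op_symbol \<one>\<^bsub>op_algebra\<^esub> = \<one>\<^bsub>toeplitz_algebra k\<^esub>"
    using op_symbol_op_poly[of 1]
    by (simp add: op_poly_one[OF k_pos] toeplitz_mat_1 toeplitz_algebra_def module_mat_simps)
qed (auto simp: op_algebra_def toeplitz_algebra_def module_mat_simps op_symbol_add op_symbol_comp
    range_op_symbol[symmetric])

lemma op_symbol_kernel: "compact_ops = a_kernel op_algebra (toeplitz_algebra k) op_symbol"
proof -
  have "T \<in> compact_ops \<longleftrightarrow> op_symbol T = 0\<^sub>m k k" for T
  proof
    assume "T \<in> compact_ops"
    then show "op_symbol T = 0\<^sub>m k k"
      using op_symbol_eqI[of T 0] by (simp add: op_poly_def toeplitz_mat_0)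
  next
    assume T: "op_symbol T = 0\<^sub>m k k"
    obtain p where p: "T - op_poly k S p \<in> compact_ops" using all_ops by blast
    then have "toeplitz_mat k p = toeplitz_mat k 0"
      using T op_symbol_eqI[OF p] by (simp add: toeplitz_mat_0)
    then have "op_poly k S p = 0" by (simp add: toeplitz_mat_eq_iff op_poly_def)
    then show "T \<in> compact_ops" using p by simp
  qed
  then show ?thesis
    by (auto simp: a_kernel_def' op_algebra_def toeplitz_algebra_def module_mat_simps)
qed

lemma calkin_iso_toeplitz:
  "\<exists>\<psi>\<in>alg_iso calkin_algebra (toeplitz_algebra k). \<forall>T. \<psi> (calkin_class T) = op_symbol T"
proof
  have surj: "op_symbol ` carrier op_algebra = carrier (toeplitz_algebra k)"
    by (simp add: op_algebra_def toeplitz_algebra_def range_op_symbol)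
  have smult: "op_symbol (c \<odot>\<^bsub>op_algebra\<^esub> T) = c \<odot>\<^bsub>toeplitz_algebra k\<^esub> op_symbol T" for c T
    by (simp add: op_algebra_def toeplitz_algebra_def module_mat_simps op_symbol_scaleR)
  have closed: "c \<odot>\<^bsub>op_algebra\<^esub> T \<in> carrier op_algebra" and mem: "T \<in> carrier op_algebra"
    for c :: real and T :: "'a \<Rightarrow>\<^sub>L 'a"
    by (simp_all add: op_algebra_def)
  note iso = quotient_algebra_iso[OF op_symbol_hom surj closed smult op_symbol_kernel]
  show "(\<lambda>C. the_elem (op_symbol ` C)) \<in> alg_iso calkin_algebra (toeplitz_algebra k)"
    unfolding calkin_algebra_def by (rule iso(1))
  show "\<forall>T. the_elem (op_symbol ` calkin_class T) = op_symbol T"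
    unfolding calkin_class_def using iso(2)[OF mem] by blast
qed

lemma calkin_basis:
  fixes b :: "nat \<Rightarrow> ('a \<Rightarrow>\<^sub>L 'a) set"
  defines "b \<equiv> \<lambda>j. calkin_class (S [^]\<^bsub>op_algebra\<^esub> j)"
  shows "inj_on b {..<k}" and "vectorspace.basis class_ring calkin_algebra (b ` {..<k})"
proof -
  interpret V: vectorspace class_ring "calkin_algebra :: (real, ('a \<Rightarrow>\<^sub>L 'a) set) Module.module"
    by (rule vectorspace_calkin_algebra)
  have op_poly_monom: "op_poly k S (Polynomial.monom 1 j) = S [^]\<^bsub>op_algebra\<^esub> j" if "j < k" for j
  proof -
    have "op_poly k S (Polynomial.monom 1 j) = (\<Sum>i<k. if i = j then S [^]\<^bsub>op_algebra\<^esub> i else 0)"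
      unfolding op_poly_def by (intro sum.cong) auto
    then show ?thesis using that by simp
  qed
  show inj: "inj_on b {..<k}"
  proof (rule inj_onI)
    fix i j assume ij: "i \<in> {..<k}" "j \<in> {..<k}" "b i = b j"
    then have "op_poly k S (Polynomial.monom 1 i - Polynomial.monom 1 j) \<in> compact_ops"
      by (simp add: b_def calkin_class_eq_iff op_poly_diff op_poly_monom)
    then have "coeff (Polynomial.monom 1 i - Polynomial.monom 1 j :: real poly) i = 0"
      using ij(1) independent by blast
    then show "i = j" by (auto split: if_splits)
  qed
  have carrier: "b ` {..<k} \<subseteq> carrier calkin_algebra" by (auto simp: b_def calkin_carrier)
  \<comment> \<open>linear combinations run over sets of vectors; injectivity turns them into sums over indices\<close>
  have lincomb: "V.lincomb a (b ` {..<k}) = calkin_class (\<Sum>j<k. a (b j) *\<^sub>R S [^]\<^bsub>op_algebra\<^esub> j)" for a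
  proof -
    have "V.lincomb a (b ` {..<k}) = (\<Oplus>\<^bsub>calkin_algebra\<^esub>j\<in>{..<k}. a (b j) \<odot>\<^bsub>calkin_algebra\<^esub> b j)"
      unfolding V.lincomb_def
      by (rule V.M.finsum_reindex[OF _ inj]) (auto simp: b_def calkin_carrier calkin_class_smult)
    then show ?thesis by (simp add: b_def calkin_class_smult calkin_finsum)
  qed
  have "V.lin_indpt (b ` {..<k})"
  proof (rule V.finite_lin_indpt2[OF _ carrier])
    fix a assume "V.lincomb a (b ` {..<k}) = \<zero>\<^bsub>calkin_algebra\<^esub>"
    then have comp: "(\<Sum>j<k. a (b j) *\<^sub>R S [^]\<^bsub>op_algebra\<^esub> j) \<in> compact_ops"
      unfolding lincomb calkin_zero calkin_class_eq_iff by simp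
    obtain p where p: "\<forall>j<k. coeff p j = a (b j)" using exists_poly_coeffs[of k "\<lambda>j. a (b j)"] by blast
    then have "op_poly k S p \<in> compact_ops" using comp by (simp add: op_poly_def)
    then show "\<forall>v\<in>b ` {..<k}. a v = \<zero>\<^bsub>class_ring\<^esub>" using p independent by auto
  qed simp
  moreover have "V.gen_set (b ` {..<k})"
  proof -
    have "C \<in> V.span (b ` {..<k})" if C: "C \<in> carrier calkin_algebra" for C
    proof -
      obtain T where T: "C = calkin_class T" using C unfolding calkin_carrier by blast
      obtain p where p: "T - op_poly k S p \<in> compact_ops" using all_ops by blast
      define a where "a = (\<lambda>v. coeff p (inv_into {..<k} b v))"
      have "C = V.lincomb a (b ` {..<k})"
        unfolding lincomb T calkin_class_eq_iff
        using p inj by (simp add: a_def op_poly_def inv_into_f_f)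
      then show ?thesis unfolding V.finite_span[OF finite_imageI[OF finite_lessThan] carrier] by auto
    qed
    moreover have "V.span (b ` {..<k}) \<subseteq> carrier calkin_algebra"
      using V.span_is_subset2[OF carrier] .
    ultimately show ?thesis by blast
  qed
  ultimately show "V.basis (b ` {..<k})" unfolding V.basis_def using carrier by blast
qed

end

section \<open>Few but not very few operators\<close>

text \<open>
  Without a constant term, a factor \<open>S\<close> can be split off on the right, so that no closure of the
  strictly singular operators under sums is needed.
\<close>
lemma op_poly_strictly_singular:
  fixes S :: "'a::banach \<Rightarrow>\<^sub>L 'a"
  assumes S: "S \<in> strictly_singular_ops" and K: "K \<in> compact_ops" and p0: "coeff p 0 = 0"
  shows "op_poly k S p + K \<in> strictly_singular_ops"
proof -
  define R where "R = (\<Sum>i<k-1. coeff p (Suc i) *\<^sub>R S [^]\<^bsub>op_algebra\<^esub> i)"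
  have "op_poly k S p = R o\<^sub>L S"
  proof (cases k)
    case 0
    then show ?thesis by (auto simp: op_poly_def R_def intro: blinfun_eqI)
  next
    case (Suc m)
    have "op_poly k S p = (\<Sum>i<m. coeff p (Suc i) *\<^sub>R S [^]\<^bsub>op_algebra\<^esub> Suc i)"
      by (simp add: op_poly_def Suc sum.lessThan_Suc_shift p0 del: sum.lessThan_Suc)
    also have "\<dots> = R o\<^sub>L S"
      by (rule blinfun_eqI) (simp add: R_def Suc blinfun.sum_left blinfun.scaleR_left op_pow_Suc)
    finally show ?thesis .
  qed
  then show ?thesis using strictly_singular_comp_plus_compact[OF S K] by simp
qed

theorem mainTheorem2:
  fixes k :: nat and S :: "'a::banach \<Rightarrow>\<^sub>L 'a"
  assumes k: "k \<ge> 2"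
    and separable: "separable_space (euclidean :: 'a topology)"
    and L_infty: "script_L_infty (UNIV :: 'a set)"
    and HI: "hereditarily_indecomposable (UNIV :: 'a set)"
    and dual: "\<exists>d. isomorphic_to_seq_space d (UNIV :: ('a \<Rightarrow>\<^sub>L real) set) ell1 ell1_norm"
    and S_noncompact: "S \<notin> compact_ops"
    and S_powers_nonzero: "\<And>j. 1 \<le> j \<Longrightarrow> j < k \<Longrightarrow> S [^]\<^bsub>op_algebra\<^esub> j \<noteq> 0"
    and S_nilpotent: "S [^]\<^bsub>op_algebra\<^esub> k = 0"
    and S_independent: "\<And>j (c :: nat \<Rightarrow> real). j < k \<Longrightarrow>
      S [^]\<^bsub>op_algebra\<^esub> j - (\<Sum>l\<in>{..<k} - {j}. c l *\<^sub>R S [^]\<^bsub>op_algebra\<^esub> l) \<notin> compact_ops"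
    and S_strictly_singular: "S \<in> strictly_singular_ops"
    and all_operators: "\<And>T :: 'a \<Rightarrow>\<^sub>L 'a. \<exists>(c :: nat \<Rightarrow> real). \<exists>K\<in>compact_ops.
      T = (\<Sum>i<k. c i *\<^sub>R S [^]\<^bsub>op_algebra\<^esub> i) + K"
  shows
    "vectorspace class_ring (calkin_algebra :: (real, ('a \<Rightarrow>\<^sub>L 'a) set) module)
     \<and> vectorspace.fin_dim class_ring (calkin_algebra :: (real, ('a \<Rightarrow>\<^sub>L 'a) set) module)
     \<and> vectorspace.dim class_ring (calkin_algebra :: (real, ('a \<Rightarrow>\<^sub>L 'a) set) module) = k
     \<and> inj_on (\<lambda>j::nat. calkin_class (S [^]\<^bsub>op_algebra\<^esub> j)) {..<k}
     \<and> vectorspace.basis class_ring calkin_algebra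
         ((\<lambda>j::nat. calkin_class (S [^]\<^bsub>op_algebra\<^esub> j)) ` {..<k})
     \<and> is_subalgebra (upper_toeplitz k) (mat_algebra k)
     \<and> upper_toeplitz k = generated_subalgebra
         ((\<lambda>j::nat. shift_mat k [^]\<^bsub>mat_algebra k\<^esub> j) ` {..<k}) (mat_algebra k)
     \<and> alg_iso (toeplitz_algebra k)
         (quotient_algebra poly_algebra (PIdl\<^bsub>poly_algebra\<^esub> (Polynomial.monom 1 k))) \<noteq> {}
     \<and> (\<exists>\<psi> \<in> alg_iso calkin_algebra (toeplitz_algebra k). \<forall>c :: nat \<Rightarrow> real.
          \<psi> (calkin_class (\<Sum>j<k. c j *\<^sub>R S [^]\<^bsub>op_algebra\<^esub> j))
            = (\<Oplus>\<^bsub>mat_algebra k\<^esub>j\<in>{..<k}.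
                 c j \<odot>\<^bsub>mat_algebra k\<^esub> (shift_mat k [^]\<^bsub>mat_algebra k\<^esub> j)))
     \<and> {c *\<^sub>R id_blinfun + K | c K. K \<in> compact_ops} \<subset> (UNIV :: ('a \<Rightarrow>\<^sub>L 'a) set)
     \<and> (UNIV :: ('a \<Rightarrow>\<^sub>L 'a) set) \<subseteq> {c *\<^sub>R id_blinfun + T | c T. T \<in> strictly_singular_ops}"
proof -
  have independent: "\<forall>j<k. coeff p j = 0" if p: "op_poly k S p \<in> compact_ops" for p
  proof (intro allI impI, rule ccontr)
    fix j assume j: "j < k" "coeff p j \<noteq> 0"
    have "op_poly k S p = coeff p j *\<^sub>R S [^]\<^bsub>op_algebra\<^esub> j
        + (\<Sum>l\<in>{..<k} - {j}. coeff p l *\<^sub>R S [^]\<^bsub>op_algebra\<^esub> l)"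
      unfolding op_poly_def using j(1) by (intro sum.remove) auto
    \<comment> \<open>dividing by the nonzero coefficient contradicts the independence of the \<open>j\<close>-th power\<close>
    then have "inverse (coeff p j) *\<^sub>R op_poly k S p = S [^]\<^bsub>op_algebra\<^esub> j
        - (\<Sum>l\<in>{..<k} - {j}. (- inverse (coeff p j) * coeff p l) *\<^sub>R S [^]\<^bsub>op_algebra\<^esub> l)"
      using j(2) by (simp add: scaleR_add_right scaleR_sum_right sum_negf)
    then show False
      using compact_ops_scaleR[OF p, of "inverse (coeff p j)"]
        S_independent[OF j(1), of "\<lambda>l. - inverse (coeff p j) * coeff p l"] by simp
  qed
  have all_ops: "\<exists>p. T - op_poly k S p \<in> compact_ops" for T :: "'a \<Rightarrow>\<^sub>L 'a"
  proof -
    obtain c K where K: "K \<in> compact_ops" "T = (\<Sum>i<k. c i *\<^sub>R S [^]\<^bsub>op_algebra\<^esub> i) + K"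
      using all_operators[of T] by blast
    obtain p where "\<forall>i<k. coeff p i = c i" using exists_poly_coeffs[of k c] by blast
    then have "T - op_poly k S p = K" by (simp add: K(2) op_poly_def)
    then show ?thesis using K(1) by auto
  qed
  interpret polynomial_calkin k S
  proof
    show "k \<ge> 1" using k by simp
  qed (fact S_nilpotent independent all_ops)+
  interpret V: vectorspace class_ring "calkin_algebra :: (real, ('a \<Rightarrow>\<^sub>L 'a) set) Module.module"
    by (rule vectorspace_calkin_algebra)
  let ?B = "(\<lambda>j::nat. calkin_class (S [^]\<^bsub>op_algebra\<^esub> j)) ` {..<k}"
  have fin: "V.fin_dim"
    using calkin_basis(2) unfolding V.fin_dim_def V.basis_def by (intro exI[of _ ?B]) simp
  have dim: "V.dim = k"
    using V.dim_basis[OF _ calkin_basis(2)] card_image[OF calkin_basis(1)] by simp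
  have psi: "\<exists>\<psi> \<in> alg_iso calkin_algebra (toeplitz_algebra k). \<forall>c :: nat \<Rightarrow> real.
      \<psi> (calkin_class (\<Sum>j<k. c j *\<^sub>R S [^]\<^bsub>op_algebra\<^esub> j))
        = (\<Oplus>\<^bsub>mat_algebra k\<^esub>j\<in>{..<k}.
             c j \<odot>\<^bsub>mat_algebra k\<^esub> (shift_mat k [^]\<^bsub>mat_algebra k\<^esub> j))"
  proof -
    have "op_symbol (\<Sum>j<k. c j *\<^sub>R S [^]\<^bsub>op_algebra\<^esub> j)
        = (\<Oplus>\<^bsub>mat_algebra k\<^esub>j\<in>{..<k}.
             c j \<odot>\<^bsub>mat_algebra k\<^esub> (shift_mat k [^]\<^bsub>mat_algebra k\<^esub> j))" for c
    proof -
      define p where "p = (\<Sum>j<k. Polynomial.monom (c j) j)"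
      have p: "coeff p j = c j" if "j < k" for j using that by (simp add: p_def coeff_sum)
      have "(\<Sum>j<k. c j *\<^sub>R S [^]\<^bsub>op_algebra\<^esub> j) = op_poly k S p"
        by (simp add: op_poly_def p)
      then have "op_symbol (\<Sum>j<k. c j *\<^sub>R S [^]\<^bsub>op_algebra\<^esub> j) = toeplitz_mat k p"
        by (simp add: op_symbol_op_poly)
      also have "\<dots> = toeplitz_mat k (\<Sum>j<k. Polynomial.smult (c j) (Polynomial.monom 1 j))"
        by (simp add: p_def smult_monom)
      finally show ?thesis
        by (simp only: shift_mat_pow module_mat_simps toeplitz_mat_smult[symmetric]
            finsum_toeplitz_mat[OF finite_lessThan])
    qed
    with calkin_iso_toeplitz show ?thesis by (elim bexE, intro bexI) auto
  qed
  have "S \<notin> {c *\<^sub>R id_blinfun + K | c K. K \<in> compact_ops}"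
  proof
    assume "S \<in> {c *\<^sub>R id_blinfun + K | c K. K \<in> compact_ops}"
    then obtain c K where K: "K \<in> compact_ops" "S = c *\<^sub>R id_blinfun + K" by blast
    have "(\<Sum>l\<in>{..<k} - {1}. (if l = 0 then c else 0) *\<^sub>R S [^]\<^bsub>op_algebra\<^esub> l)
        = (\<Sum>l\<in>{..<k} - {1}. if l = 0 then c *\<^sub>R id_blinfun else 0)"
      by (intro sum.cong) (auto simp: op_pow_0)
    also have "\<dots> = c *\<^sub>R id_blinfun" using k by simp
    finally have sum: "(\<Sum>l\<in>{..<k} - {1}. (if l = 0 then c else 0) *\<^sub>R S [^]\<^bsub>op_algebra\<^esub> l)
        = c *\<^sub>R id_blinfun" .
    have "S [^]\<^bsub>op_algebra\<^esub> (1::nat) = S"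
      using op_pow_Suc[of S 0] by (auto intro: blinfun_eqI)
    then have "S [^]\<^bsub>op_algebra\<^esub> (1::nat)
        - (\<Sum>l\<in>{..<k} - {1}. (if l = 0 then c else 0) *\<^sub>R S [^]\<^bsub>op_algebra\<^esub> l) = K"
      unfolding sum using K(2) by simp
    then show False using S_independent[of 1 "\<lambda>l. if l = 0 then c else 0"] k K(1) by auto
  qed
  then have few: "{c *\<^sub>R id_blinfun + K | c K. K \<in> compact_ops} \<subset> (UNIV :: ('a \<Rightarrow>\<^sub>L 'a) set)" by blast
  have "T \<in> {c *\<^sub>R id_blinfun + T | c T. T \<in> strictly_singular_ops}" for T :: "'a \<Rightarrow>\<^sub>L 'a"
  proof -
    obtain p where p: "T - op_poly k S p \<in> compact_ops" using all_ops by blast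
    let ?q = "p - [:coeff p 0:]"
    have "op_poly k S [:coeff p 0:] = coeff p 0 *\<^sub>R id_blinfun"
      using op_poly_smult[of k S "coeff p 0" 1] op_poly_one[of k S] k by simp
    then have "T = coeff p 0 *\<^sub>R id_blinfun + (op_poly k S ?q + (T - op_poly k S p))"
      by (simp add: op_poly_diff)
    moreover have "op_poly k S ?q + (T - op_poly k S p) \<in> strictly_singular_ops"
      by (rule op_poly_strictly_singular[OF S_strictly_singular p]) simp
    ultimately show ?thesis by blast
  qed
  then have very_few: "(UNIV :: ('a \<Rightarrow>\<^sub>L 'a) set) \<subseteq> {c *\<^sub>R id_blinfun + T | c T. T \<in> strictly_singular_ops}"
    by blast
  show ?thesis
    by (intro conjI V.vectorspace_axioms fin dim calkin_basis is_subalgebra_upper_toeplitz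
        upper_toeplitz_generated toeplitz_algebra_iso_quotient psi few very_few)
qed

end
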